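(* Let $i\in\{1,2,3\}$ and $N\in\mathbb N$, and consider the orthogonal direct sum decomposition $$P_N=\sum_{\ell=0}^{\lfloor N/2\rfloor}R_i^\ell\bigl({\rm Ker}(L_i)\cap P_{N-2\ell}\bigr).$$ The following hold. (i) Each summand is an irreducible submodule for the $i$th Lie subalgebra of $\mathfrak{sl}_4(\mathbb C)$ isomorphic to $\mathfrak{sl}_2(\mathbb C)\oplus\mathfrak{sl}_2(\mathbb C)$. (ii) For $0\le\ell\le\lfloor N/2\rfloor$ the $\ell$-summand has dimension $(N-2\ell+1)^2$. (iii) For $0\le\ell\le\lfloor N/2\rfloor$ the $\ell$-summand is isomorphic to $\mathbb V_{N-2\ell}\otimes\mathbb V_{N-2\ell}$ as a module for the $i$th Lie subalgebra of $\mathfrak{sl}_4(\mathbb C)$ isomorphic to $\mathfrak{sl}_2(\mathbb C)\oplus\mathfrak{sl}_2(\mathbb C)$. (iv) For $0\le\ell\le\lfloor N/2\rfloor$ the $\ell$-summand is an eigenspace for the action of $C_i$ on $P_N$; the eigenvalue is $$\frac{(N-2\ell)(N-2\ell+2)}2 .$$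
   Context: $\mathbb N=\{0,1,2,\ldots\}$. With $E_{a,b}$ the $4\times4$ matrix units, define in $\mathfrak{sl}_4(\mathbb C)$: $A_1=E_{12}+E_{21}+E_{34}+E_{43}$, $A_2=E_{13}+E_{31}+E_{24}+E_{42}$, $A_3=E_{14}+E_{41}+E_{23}+E_{32}$, $A_1^*={\rm diag}(1,1,-1,-1)$, $A_2^*={\rm diag}(1,-1,1,-1)$, $A_3^*={\rm diag}(1,-1,-1,1)$. $P=\mathbb C[x,y,z,w]$ is an $\mathfrak{sl}_4(\mathbb C)$-module on which every element acts as a derivation, and on the degree-one part $\varphi\in\mathfrak{sl}_4(\mathbb C)$ acts by its matrix with respect to the ordered basis $(v_1,v_2,v_3,v_4)=(x,y,z,w)$, i.e. $\varphi v_b=\sum_a\varphi_{ab}v_a$. $P_N$ is the subspace of homogeneous polynomials of total degree $N$. Orthogonality refers to the Hermitian form on $P$ for which the monomials $x^ry^sz^tw^u$ are mutually orthogonal with square norm $r!s!t!u!$. With $D_x,D_y,D_z,D_w$ the partial derivatives, $L_i,R_i\in{\rm End}(P)$ are $L_1=D_xD_y-D_zD_w$, $L_2=D_xD_z-D_wD_y$, $L_3=D_xD_w-D_yD_z$; $R_1(f)=(xy-zw)f$, $R_2(f)=(xz-wy)f$, $R_3(f)=(xw-yz)f$. $\Omega\in{\rm End}(P)$ acts on each $P_N$ as $N$ times the identity $I$, and $C_i=\frac{(\Omega+2I)^2}2-L_iR_i-R_iL_i$, which leaves each $P_N$ invariant. The $i$th Lie subalgebra of $\mathfrak{sl}_4(\mathbb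 C)$ isomorphic to $\mathfrak{sl}_2(\mathbb C)\oplus\mathfrak{sl}_2(\mathbb C)$ is the Lie subalgebra generated by $A_j,A_k,A_j^*,A_k^*$, where $j,k$ are the two elements of $\{1,2,3\}\setminus\{i\}$. It is identified with $\mathfrak{sl}_2(\mathbb C)\oplus\mathfrak{sl}_2(\mathbb C)$ via the isomorphism $(A,0)\mapsto A_j$, $(A^*,0)\mapsto A_k^*$, $(0,A)\mapsto A_k$, $(0,A^* )\mapsto A_j^*$, where $A=\begin{pmatrix}0&1\\1&0\end{pmatrix}$ and $A^*={\rm diag}(1,-1)$ (generators of $\mathfrak{sl}_2(\mathbb C)$). $\mathbb V_M$ is the irreducible $\mathfrak{sl}_2(\mathbb C)$-module of dimension $M+1$, and $(a,b)\in\mathfrak{sl}_2(\mathbb C)\oplus\mathfrak{sl}_2(\mathbb C)$ acts on $\mathbb V_M\otimes\mathbb V_M$ by $u\otimes v\mapsto(au)\otimes v+u\otimes(bv)$. *)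

theory Defs
  imports "HOL-Analysis.Analysis" "HOL-Library.Poly_Mapping"
begin

section \<open>Vector spaces of finitely supported functions\<close>

text \<open>
  All complex vector spaces below are subspaces of \<^typ>\<open>'b \<Rightarrow>\<^sub>0 complex\<close>, the space with basis
  \<^typ>\<open>'b\<close>. As \<^typ>\<open>'b\<close> is arbitrary, this covers every complex vector space up to isomorphism.
\<close>

abbreviation lookup :: "('b \<Rightarrow>\<^sub>0 'c::zero) \<Rightarrow> 'b \<Rightarrow> 'c" where
  "lookup \<equiv> Poly_Mapping.lookup"

abbreviation keys :: "('b \<Rightarrow>\<^sub>0 'c::zero) \<Rightarrow> 'b set" where
  "keys \<equiv> Poly_Mapping.keys"

definition pscale :: "complex \<Rightarrow> ('b \<Rightarrow>\<^sub>0 complex) \<Rightarrow> ('b \<Rightarrow>\<^sub>0 complex)" where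
  "pscale c f = Poly_Mapping.map ((*) c) f"

lemma lookup_pscale [simp]: "lookup (pscale c f) m = c * lookup f m"
  by (simp add: pscale_def Poly_Mapping.map.rep_eq when_def)

interpretation pm: vector_space "pscale :: complex \<Rightarrow> ('b \<Rightarrow>\<^sub>0 complex) \<Rightarrow> ('b \<Rightarrow>\<^sub>0 complex)"
  by unfold_locales (auto intro!: poly_mapping_eqI simp: lookup_add algebra_simps)

definition linear_map_on :: "('b \<Rightarrow>\<^sub>0 complex) set \<Rightarrow> (('b \<Rightarrow>\<^sub>0 complex) \<Rightarrow> ('c \<Rightarrow>\<^sub>0 complex)) \<Rightarrow> bool" where
  "linear_map_on V f \<longleftrightarrow>
     (\<forall>u\<in>V. \<forall>v\<in>V. f (u + v) = f u + f v) \<and> (\<forall>c. \<forall>v\<in>V. f (pscale c v) = pscale c (f v))"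


section \<open>Lie algebras of complex matrices and their modules\<close>

definition mscale :: "complex \<Rightarrow> complex^'n^'m \<Rightarrow> complex^'n^'m" where
  "mscale c M = (\<chi> a b. c * M $ a $ b)"

definition bracket :: "complex^'n^'n \<Rightarrow> complex^'n^'n \<Rightarrow> complex^'n^'n" where
  "bracket M N = M ** N - N ** M"

definition sl :: "(complex^'n^'n) set" where
  "sl = {M. trace M = 0}"

inductive_set lie_generated :: "(complex^'n^'n) set \<Rightarrow> (complex^'n^'n) set"
  for S :: "(complex^'n^'n) set" where
  base: "M \<in> S \<Longrightarrow> M \<in> lie_generated S"
| zero: "0 \<in> lie_generated S"
| add: "M \<in> lie_generated S \<Longrightarrow> N \<in> lie_generated S \<Longrightarrow> M + N \<in> lie_generated S"
| scale: "M \<in> lie_generated S \<Longrightarrow> mscale c M \<in> lie_generated S"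
| bracket: "M \<in> lie_generated S \<Longrightarrow> N \<in> lie_generated S \<Longrightarrow> bracket M N \<in> lie_generated S"

text \<open>\<open>V\<close> is a module for the Lie algebra \<open>\<gg>\<close>, where \<open>a \<in> \<gg>\<close> acts on \<open>V\<close> as \<open>\<rho> a\<close>.\<close>

definition lie_module ::
  "(complex^'n^'n) set \<Rightarrow> (complex^'n^'n \<Rightarrow> ('b \<Rightarrow>\<^sub>0 complex) \<Rightarrow> ('b \<Rightarrow>\<^sub>0 complex))
     \<Rightarrow> ('b \<Rightarrow>\<^sub>0 complex) set \<Rightarrow> bool" where
  "lie_module \<gg> \<rho> V \<longleftrightarrow> pm.subspace V \<and>
     (\<forall>a\<in>\<gg>. \<rho> a ` V \<subseteq> V \<and> linear_map_on V (\<rho> a)) \<and>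
     (\<forall>v\<in>V. (\<forall>a\<in>\<gg>. \<forall>b\<in>\<gg>. \<rho> (a + b) v = \<rho> a v + \<rho> b v) \<and>
             (\<forall>c. \<forall>a\<in>\<gg>. \<rho> (mscale c a) v = pscale c (\<rho> a v)) \<and>
             (\<forall>a\<in>\<gg>. \<forall>b\<in>\<gg>. \<rho> (bracket a b) v = \<rho> a (\<rho> b v) - \<rho> b (\<rho> a v)))"

definition irreducible_module ::
  "(complex^'n^'n) set \<Rightarrow> (complex^'n^'n \<Rightarrow> ('b \<Rightarrow>\<^sub>0 complex) \<Rightarrow> ('b \<Rightarrow>\<^sub>0 complex))
     \<Rightarrow> ('b \<Rightarrow>\<^sub>0 complex) set \<Rightarrow> bool" where
  "irreducible_module \<gg> \<rho> V \<longleftrightarrow> lie_module \<gg> \<rho> V \<and> V \<noteq> {0} \<and>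
     (\<forall>U. U \<subseteq> V \<and> lie_module \<gg> \<rho> U \<longrightarrow> U = {0} \<or> U = V)"

definition module_isomorphic ::
  "'g set \<Rightarrow> ('g \<Rightarrow> ('b \<Rightarrow>\<^sub>0 complex) \<Rightarrow> ('b \<Rightarrow>\<^sub>0 complex)) \<Rightarrow> ('b \<Rightarrow>\<^sub>0 complex) set
     \<Rightarrow> ('g \<Rightarrow> ('c \<Rightarrow>\<^sub>0 complex) \<Rightarrow> ('c \<Rightarrow>\<^sub>0 complex)) \<Rightarrow> ('c \<Rightarrow>\<^sub>0 complex) set \<Rightarrow> bool" where
  "module_isomorphic \<gg> \<rho> V \<sigma> W \<longleftrightarrow>
     (\<exists>f. linear_map_on V f \<and> bij_betw f V W \<and> (\<forall>a\<in>\<gg>. \<forall>v\<in>V. f (\<rho> a v) = \<sigma> a (f v)))"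


section \<open>Tensor products of \<open>\<ss>\<ll>\<^sub>2\<close>-modules\<close>

text \<open>The tensor product of the spaces with bases \<^typ>\<open>'b\<close> and \<^typ>\<open>'c\<close> is the space with basis
  \<^typ>\<open>'b \<times> 'c\<close>; the tensor product of subspaces is realized inside it.\<close>

definition tensor :: "('b \<Rightarrow>\<^sub>0 complex) \<Rightarrow> ('c \<Rightarrow>\<^sub>0 complex) \<Rightarrow> (('b \<times> 'c) \<Rightarrow>\<^sub>0 complex)" where
  "tensor u v = (\<Sum>p\<in>keys u. \<Sum>q\<in>keys v. Poly_Mapping.single (p, q) (lookup u p * lookup v q))"

lemma lookup_tensor: "lookup (tensor u v) (p, q) = lookup u p * lookup v q"
proof -
  have "lookup (tensor u v) (p, q)
      = (\<Sum>p'\<in>keys u. \<Sum>q'\<in>keys v. if q' = q then (if p' = p then lookup u p * lookup v q else 0) else 0)"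
    unfolding tensor_def lookup_sum
    by (intro sum.cong) (auto simp: lookup_single when_def)
  also have "\<dots> = lookup u p * lookup v q"
    by (cases "lookup v q = 0") (auto simp: sum.delta in_keys_iff)
  finally show ?thesis .
qed

definition tensor_space ::
  "('b \<Rightarrow>\<^sub>0 complex) set \<Rightarrow> ('c \<Rightarrow>\<^sub>0 complex) set \<Rightarrow> (('b \<times> 'c) \<Rightarrow>\<^sub>0 complex) set" where
  "tensor_space V W = pm.span {tensor u v | u v. u \<in> V \<and> v \<in> W}"

text \<open>\<open>\<tau>\<close> is the action of \<open>\<ss>\<ll>\<^sub>2 \<oplus> \<ss>\<ll>\<^sub>2\<close> on \<open>V \<otimes> V\<close> induced by the action \<open>\<rho>\<close> of \<open>\<ss>\<ll>\<^sub>2\<close> on \<open>V\<close>. On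
  \<open>V \<otimes> V\<close> it is determined by this condition, since the pure tensors span.\<close>

definition tensor_action ::
  "(complex^2^2 \<Rightarrow> ('b \<Rightarrow>\<^sub>0 complex) \<Rightarrow> ('b \<Rightarrow>\<^sub>0 complex)) \<Rightarrow> ('b \<Rightarrow>\<^sub>0 complex) set
     \<Rightarrow> ((complex^2^2) \<times> (complex^2^2) \<Rightarrow> (('b \<times> 'b) \<Rightarrow>\<^sub>0 complex) \<Rightarrow> (('b \<times> 'b) \<Rightarrow>\<^sub>0 complex)) \<Rightarrow> bool" where
  "tensor_action \<rho> V \<tau> \<longleftrightarrow>
     (\<forall>a\<in>sl. \<forall>b\<in>sl. linear_map_on (tensor_space V V) (\<tau> (a, b)) \<and>
        (\<forall>u\<in>V. \<forall>v\<in>V. \<tau> (a, b) (tensor u v) = tensor (\<rho> a u) v + tensor u (\<rho> b v)))"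


section \<open>Polynomials\<close>

text \<open>A polynomial in variables indexed by \<^typ>\<open>'n\<close> maps each exponent vector to its coefficient.\<close>

type_synonym 'n polynomial = "('n \<Rightarrow>\<^sub>0 nat) \<Rightarrow>\<^sub>0 complex"

definition var :: "'n \<Rightarrow> 'n polynomial" where
  "var b = Poly_Mapping.single (Poly_Mapping.single b 1) 1"

definition D :: "'n \<Rightarrow> 'n polynomial \<Rightarrow> 'n polynomial" where
  "D b f = (\<Sum>m\<in>keys f. Poly_Mapping.single (m - Poly_Mapping.single b 1)
                         (of_nat (lookup m b) * lookup f m))"

definition mdeg :: "('n::finite \<Rightarrow>\<^sub>0 nat) \<Rightarrow> nat" where
  "mdeg m = (\<Sum>b\<in>UNIV. lookup m b)"

definition homog :: "nat \<Rightarrow> ('n::finite) polynomial set" where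
  "homog N = {f. \<forall>m\<in>keys f. mdeg m = N}"

definition herm :: "('n::finite) polynomial \<Rightarrow> 'n polynomial \<Rightarrow> complex" where
  "herm f g = (\<Sum>m\<in>keys f. lookup f m * cnj (lookup g m) * of_nat (\<Prod>b\<in>UNIV. fact (lookup m b)))"

text \<open>The derivation \<open>\<Sum>\<^sub>b (\<phi> v\<^sub>b) \<partial>\<^sub>b\<close>, where \<open>\<phi> v\<^sub>b = \<Sum>\<^sub>a \<phi>\<^sub>a\<^sub>b v\<^sub>a\<close>.\<close>

definition act :: "complex^'n^'n \<Rightarrow> ('n::finite) polynomial \<Rightarrow> 'n polynomial" where
  "act \<phi> f = (\<Sum>b\<in>UNIV. (\<Sum>a\<in>UNIV. pscale (\<phi> $ a $ b) (var a)) * D b f)"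

definition Omega :: "('n::finite) polynomial \<Rightarrow> 'n polynomial" where
  "Omega f = Poly_Mapping.mapp (\<lambda>m c. of_nat (mdeg m) * c) f"


lemma poly_mapping_sum_single: "(f :: 'b \<Rightarrow>\<^sub>0 'c::comm_monoid_add) = (\<Sum>m\<in>keys f. Poly_Mapping.single m (lookup f m))"
proof (rule poly_mapping_eqI)
  fix k
  have "lookup (\<Sum>m\<in>keys f. Poly_Mapping.single m (lookup f m)) k
        = (\<Sum>m\<in>keys f. if m = k then lookup f m else 0)"
    unfolding lookup_sum by (rule sum.cong) (auto simp: lookup_single when_def)
  also have "\<dots> = lookup f k"
    by (auto simp: sum.delta in_keys_iff)
  finally show "lookup f k = lookup (\<Sum>m\<in>keys f. Poly_Mapping.single m (lookup f m)) k" by simp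
qed

lemma poly_mapping_induct [case_names single add]:
  fixes f :: "'b \<Rightarrow>\<^sub>0 'c::comm_monoid_add"
  assumes "\<And>m c. P (Poly_Mapping.single m c)" and "\<And>f g. P f \<Longrightarrow> P g \<Longrightarrow> P (f + g)"
  shows "P f"
proof -
  have "P (\<Sum>m\<in>S. Poly_Mapping.single m (lookup f m))" if "finite S" for S
    using that
  proof induction
    case empty
    show ?case using assms(1)[of undefined 0] by simp
  qed (auto intro: assms)
  then show ?thesis using poly_mapping_sum_single[of f] by (metis finite_keys)
qed

lemma pm_minus_single: 
  fixes m k :: "'n \<Rightarrow>\<^sub>0 nat"
  assumes "lookup m b \<noteq> 0"
  shows "m - Poly_Mapping.single b 1 = k \<longleftrightarrow> m = k + Poly_Mapping.single b 1"
proof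
  assume "m - Poly_Mapping.single b 1 = k"
  then have "lookup m c = lookup (k + Poly_Mapping.single b 1) c" for c
    using assms by (auto simp: lookup_add lookup_minus lookup_single when_def)
  then show "m = k + Poly_Mapping.single b 1" by (rule poly_mapping_eqI)
qed simp

lemma lookup_D: "lookup (D b f) m = of_nat (lookup m b + 1) * lookup f (m + Poly_Mapping.single b 1)"
proof -
  have "lookup (D b f) m = (\<Sum>k\<in>keys f. if k = m + Poly_Mapping.single b 1 then of_nat (lookup k b) * lookup f k else 0)"
    unfolding D_def lookup_sum
  proof (rule sum.cong)
    fix k assume "k \<in> keys f"
    show "lookup (Poly_Mapping.single (k - Poly_Mapping.single b 1) (of_nat (lookup k b) * lookup f k)) m
      = (if k = m + Poly_Mapping.single b 1 then of_nat (lookup k b) * lookup f k else 0)"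
      using pm_minus_single[of k b m] 
      by (cases "lookup k b = 0") (auto simp: lookup_single when_def lookup_add)
  qed simp
  also have "\<dots> = of_nat (lookup m b + 1) * lookup f (m + Poly_Mapping.single b 1)"
    by (auto simp: sum.delta in_keys_iff lookup_add)
  finally show ?thesis .
qed

lemma D_add: "D b (f + g) = D b f + D b g"
  by (rule poly_mapping_eqI) (simp add: lookup_D lookup_add algebra_simps)

lemma D_pscale: "D b (pscale c f) = pscale c (D b f)"
  by (rule poly_mapping_eqI) (simp add: lookup_D)

lemma D_single: "D b (Poly_Mapping.single m c) = Poly_Mapping.single (m - Poly_Mapping.single b 1) (of_nat (lookup m b) * c)"
  by (cases "c = 0") (auto simp: D_def)

lemma D_var: "D b (var a) = (if a = b then 1 else 0)"
  by (simp add: var_def D_single lookup_single)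

lemma D_mult: "D b (f * g) = D b f * g + f * D b g"
proof (induction f rule: poly_mapping_induct)
  case (single m c)
  show ?case
  proof (induction g rule: poly_mapping_induct)
    case (single n d)
    let ?e = "Poly_Mapping.single b 1 :: 'a \<Rightarrow>\<^sub>0 nat"
    have 1: "lookup m b \<noteq> 0 \<Longrightarrow> m - ?e + n = m + n - ?e"
      by (auto intro!: poly_mapping_eqI simp: lookup_add lookup_minus lookup_single when_def)
    have 2: "lookup n b \<noteq> 0 \<Longrightarrow> m + (n - ?e) = m + n - ?e"
      by (auto intro!: poly_mapping_eqI simp: lookup_add lookup_minus lookup_single when_def)
    show ?case
      using 1 2
      by (cases "lookup m b = 0"; cases "lookup n b = 0")
         (auto simp: D_single mult_single lookup_add single_add[symmetric] algebra_simps)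
  next
    case (add f g)
    then show ?case by (simp add: D_add algebra_simps)
  qed
next
  case (add f g)
  then show ?case by (simp add: D_add algebra_simps)
qed

lemma D_commute: "D a (D b f) = D b (D a f)"
  by (rule poly_mapping_eqI) (simp add: lookup_D lookup_add lookup_single add_ac mult_ac when_def)

lemma pscale_mult: "pscale c f * g = pscale c (f * g)" "f * pscale c g = pscale c (f * g)" 
  for f g :: "'n polynomial"
  by (simp_all add: pscale_def mult_map_scale_conv_mult mult_ac)

lemma act_var: "act \<phi> (var b) = (\<Sum>a\<in>UNIV. pscale (\<phi> $ a $ b) (var a))"
proof -
  have "act \<phi> (var b) = (\<Sum>c\<in>UNIV. if c = b then (\<Sum>a\<in>UNIV. pscale (\<phi> $ a $ b) (var a)) else 0)"
    unfolding act_def by (rule sum.cong) (auto simp: D_var)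
  then show ?thesis by simp
qed

lemma act_add: "act \<phi> (f + g) = act \<phi> f + act \<phi> g"
  by (simp add: act_def D_add algebra_simps sum.distrib)

lemma act_pscale: "act \<phi> (pscale c f) = pscale c (act \<phi> f)"
  by (simp add: act_def D_pscale pscale_mult pm.scale_sum_right)

lemma act_mult: "act \<phi> (f * g) = act \<phi> f * g + f * act \<phi> g"
  by (simp add: act_def D_mult algebra_simps sum.distrib sum_distrib_left)

lemma act_minus: "act \<phi> (f - g) = act \<phi> f - act \<phi> g"
  using act_add[of \<phi> "f - g" g] by simp

lemma act_0: "act \<phi> 0 = 0"
  by (simp add: act_def D_def)

lemma act_single_0: "act \<phi> (Poly_Mapping.single 0 c) = 0"
  by (simp add: act_def D_single)

lemma single_induct_var:
  fixes m :: "'n::finite \<Rightarrow>\<^sub>0 nat"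
  assumes "P 0" and "\<And>m b. P m \<Longrightarrow> P (Poly_Mapping.single b 1 + m)"
  shows "P m"
proof (induction "mdeg m" arbitrary: m)
  case 0
  then have "m = 0" by (auto simp: mdeg_def intro!: poly_mapping_eqI)
  then show ?case using assms by simp
next
  case (Suc k)
  then obtain b where b: "lookup m b \<noteq> 0" by (metis Zero_not_Suc mdeg_def sum.neutral)
  define n where "n = m - Poly_Mapping.single b 1"
  have m: "m = Poly_Mapping.single b 1 + n"
    using pm_minus_single[OF b, of n] n_def by (metis add.commute)
  have "mdeg m = Suc (mdeg n)"
    unfolding m by (simp add: mdeg_def lookup_add sum.distrib lookup_single when_def)
  with Suc(2) have "k = mdeg n" by simp
  from Suc(1)[OF this] assms(2) m show ?case by simp
qed

lemma act_bracket: "act (bracket \<phi> \<psi>) f = act \<phi> (act \<psi> f) - act \<psi> (act \<phi> f)"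
proof (induction f rule: poly_mapping_induct)
  case (single m c)
  show ?case
  proof (induction m rule: single_induct_var)
    case 1
    show ?case by (simp add: act_single_0 act_0)
  next
    case (2 m b)
    have sums: "act \<alpha> (\<Sum>a\<in>S. pscale (h a) (var a)) = (\<Sum>a\<in>S. pscale (h a) (act \<alpha> (var a)))"
      if "finite S" for \<alpha> and h and S :: "'a set"
      using that
      by (induction S) (auto simp: act_add act_pscale act_0)
    have v: "act (bracket \<phi> \<psi>) (var b) = act \<phi> (act \<psi> (var b)) - act \<psi> (act \<phi> (var b))"
    proof -
      have *: "act \<alpha> (act \<beta> (var b)) = (\<Sum>a\<in>UNIV. pscale ((\<alpha> ** \<beta>) $ a $ b) (var a))" for \<alpha> \<beta> :: "complex^'a^'a"
        unfolding act_var sums[OF finite] pm.scale_sum_right pm.scale_scale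
        by (subst sum.swap) (simp add: matrix_matrix_mult_def pm.scale_sum_left mult.commute)
      show ?thesis unfolding * unfolding act_var bracket_def
        by (simp add: pm.scale_left_diff_distrib sum_subtractf)
    qed
    have s: "Poly_Mapping.single (Poly_Mapping.single b 1 + m) c = var b * Poly_Mapping.single m c"
      by (simp add: var_def mult_single)
    show ?case unfolding s act_mult v 2
      by (simp add: act_add act_mult algebra_simps)
  qed
next
  case (add f g)
  then show ?case by (simp add: act_add)
qed

lemma lie_module_act: "lie_module sl act V" if "pm.subspace V" "\<And>a. a \<in> sl \<Longrightarrow> act a ` V \<subseteq> V"
proof -
  have 1: "act (a + b) v = act a v + act b v" for a b :: "complex^'a^'a" and v
    by (simp add: act_def pm.scale_left_distrib sum.distrib algebra_simps)
  have 2: "act (mscale c a) v = pscale c (act a v)" for c and a :: "complex^'a^'a" and v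
    by (simp add: act_def mscale_def pm.scale_sum_right sum_distrib_right pscale_mult)
  show ?thesis using that
    by (auto simp: lie_module_def linear_map_on_def act_add act_pscale 1 2 act_bracket)
qed

corollary lie_module_polynomials: "lie_module sl act (UNIV :: ('n::finite) polynomial set)"
  by (rule lie_module_act) (auto simp: pm.subspace_def)

lemma Omega_homog: "f \<in> homog N \<Longrightarrow> Omega f = pscale (of_nat N) f"
  by (rule poly_mapping_eqI) (auto simp: Omega_def lookup_mapp homog_def in_keys_iff when_def)


section \<open>Binary forms\<close>

text \<open>The irreducible \<open>\<ss>\<ll>\<^sub>2\<close>-module of dimension \<open>M + 1\<close> is quantified over as an arbitrary module with
  these two properties. Binary forms of degree \<open>M\<close> show that it exists.\<close>

lemma subspace_homog: "pm.subspace (homog N :: ('n::finite) polynomial set)"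
proof -
  have "homog N = {f :: ('n::finite) polynomial. \<forall>m. mdeg m \<noteq> N \<longrightarrow> lookup f m = 0}"
    by (auto simp: homog_def in_keys_iff)
  then show ?thesis by (simp add: pm.subspace_def lookup_add)
qed

lemma act_homog:
  assumes "f \<in> homog N"
  shows "act \<phi> f \<in> homog N"
proof -
  have "pscale c (var a) * D b f \<in> homog N" for c a b
  proof -
    have "mdeg m = N" if "m \<in> keys (var a * D b f)" for m
    proof -
      obtain n where n: "n \<in> keys (D b f)" "m = Poly_Mapping.single a 1 + n"
        using \<open>m \<in> _\<close> keys_mult[of "var a" "D b f"] by (auto simp: var_def)
      then have "n + Poly_Mapping.single b 1 \<in> keys f"
        by (simp add: in_keys_iff lookup_D)
      then have "mdeg (n + Poly_Mapping.single b 1) = N"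
        using assms by (simp add: homog_def)
      then show ?thesis
        by (simp add: n(2) mdeg_def lookup_add sum.distrib lookup_single when_def)
    qed
    then have "var a * D b f \<in> homog N" by (simp add: homog_def)
    then show ?thesis by (simp add: pscale_mult pm.subspace_scale[OF subspace_homog])
  qed
  then show ?thesis
    by (auto simp: act_def sum_distrib_right intro!: pm.subspace_sum[OF subspace_homog])
qed

definition mon :: "nat \<Rightarrow> nat \<Rightarrow> 2 polynomial" where
  "mon a b = Poly_Mapping.single (Poly_Mapping.single 1 a + Poly_Mapping.single 2 b) 1"

lemma lookup_mon: "lookup (mon a b) m = (if lookup m 1 = a \<and> lookup m 2 = b then 1 else 0)"
proof -
  have "Poly_Mapping.single 1 a + Poly_Mapping.single 2 b = m \<longleftrightarrow> lookup m 1 = a \<and> lookup m (2::2) = b"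
    by (auto simp: poly_mapping_eq_iff fun_eq_iff lookup_add lookup_single when_def forall_2)
  then show ?thesis by (simp add: mon_def lookup_single when_def)
qed

lemma mon_homog: "a + b = N \<Longrightarrow> mon a b \<in> homog N"
  by (auto simp: homog_def in_keys_iff lookup_mon mdeg_def sum_2 split: if_splits)

lemma mon_expansion:
  assumes "f \<in> homog M"
  shows "f = (\<Sum>j\<le>M. pscale (lookup f (Poly_Mapping.single 1 (M - j) + Poly_Mapping.single 2 j)) (mon (M - j) j))"
    (is "_ = ?r")
proof (rule poly_mapping_eqI)
  fix m :: "2 \<Rightarrow>\<^sub>0 nat"
  have "lookup ?r m = (\<Sum>j\<le>M. if j = lookup m 2 then (if lookup m 1 = M - j then lookup f m else 0) else 0)"
    unfolding lookup_sum
  proof (rule sum.cong)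
    fix j assume "j \<in> {..M}"
    have "Poly_Mapping.single 1 (M - j) + Poly_Mapping.single 2 j = m" if "lookup m 1 = M - j" "lookup m (2::2) = j"
      using that by (auto simp: poly_mapping_eq_iff fun_eq_iff lookup_add lookup_single when_def forall_2)
    then show "lookup (pscale (lookup f (Poly_Mapping.single 1 (M - j) + Poly_Mapping.single 2 j)) (mon (M - j) j)) m
       = (if j = lookup m 2 then (if lookup m 1 = M - j then lookup f m else 0) else 0)"
      by (auto simp: lookup_mon)
  qed simp
  also have "\<dots> = lookup f m"
  proof (cases "lookup f m = 0")
    case False
    then have "mdeg m = M" using assms by (simp add: homog_def in_keys_iff)
    then show ?thesis by (auto simp: mdeg_def sum_2)
  qed (auto intro!: sum.neutral)
  finally show "lookup f m = lookup ?r m" by simp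
qed

definition raise :: "complex^2^2" where "raise = (\<chi> r c. if r = 1 \<and> c = 2 then 1 else 0)"
definition lower :: "complex^2^2" where "lower = (\<chi> r c. if r = 2 \<and> c = 1 then 1 else 0)"

lemma act_raise: "act raise (mon a b) = pscale (of_nat b) (mon (Suc a) (b - 1))"
proof -
  have "Poly_Mapping.single (1::2) (Suc 0) + (Poly_Mapping.single 1 a + Poly_Mapping.single 2 b - Poly_Mapping.single 2 (Suc 0))
      = Poly_Mapping.single 1 (Suc a) + Poly_Mapping.single 2 (b - 1)"
    by (auto simp: poly_mapping_eq_iff fun_eq_iff lookup_add lookup_minus lookup_single when_def forall_2)
  then show ?thesis
    by (simp add: act_def raise_def sum_2 mon_def D_single var_def mult_single pscale_mult
      lookup_add lookup_single pscale_def)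
qed

lemma act_lower: "act lower (mon a b) = pscale (of_nat a) (mon (a - 1) (Suc b))"
proof -
  have "Poly_Mapping.single (2::2) (Suc 0) + (Poly_Mapping.single 1 a + Poly_Mapping.single 2 b - Poly_Mapping.single 1 (Suc 0))
      = Poly_Mapping.single 1 (a - 1) + Poly_Mapping.single 2 (Suc b)"
    by (auto simp: poly_mapping_eq_iff fun_eq_iff lookup_add lookup_minus lookup_single when_def forall_2)
  then show ?thesis
    by (simp add: act_def lower_def sum_2 mon_def D_single var_def mult_single pscale_mult
      lookup_add lookup_single pscale_def)
qed

lemma act_raise_pow:
  "(act raise ^^ k) (mon a b) = pscale (of_nat (\<Prod>i<k. b - i)) (mon (a + k) (b - k))"
  by (induction k) (simp_all add: act_pscale act_raise mult.commute)

lemma act_lower_pow: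
  "(act lower ^^ k) (mon a b) = pscale (of_nat (\<Prod>i<k. a - i)) (mon (a - k) (b + k))"
  by (induction k) (simp_all add: act_pscale act_lower mult.commute)

lemma act_pow_sum:
  "(act \<phi> ^^ k) (\<Sum>j\<in>S. pscale (c j) (g j)) = (\<Sum>j\<in>S. pscale (c j) ((act \<phi> ^^ k) (g j)))"
proof (induction k)
  case (Suc k)
  have "act \<phi> (\<Sum>j\<in>S. pscale (c j) (h j)) = (\<Sum>j\<in>S. pscale (c j) (act \<phi> (h j)))" for h
    by (induction S rule: infinite_finite_induct) (auto simp: act_0 act_add act_pscale)
  with Suc show ?case by simp
qed simp

lemma irreducible_module_homog: "irreducible_module sl act (homog M :: 2 polynomial set)"
proof -
  have sl: "raise \<in> sl" "lower \<in> sl"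
    by (simp_all add: sl_def trace_def raise_def lower_def sum_2)
  have nz: "mon M 0 \<noteq> 0"
    by (metis lookup_mon lookup_zero mon_def lookup_single_eq zero_neq_one)
  have "U = homog M" if U: "U \<subseteq> homog M" "lie_module sl act U" "U \<noteq> {0}" for U :: "2 polynomial set"
  proof -
    have sub: "pm.subspace U" and inv: "\<And>a g. a \<in> sl \<Longrightarrow> g \<in> U \<Longrightarrow> act a g \<in> U"
      using U(2) by (auto simp: lie_module_def)
    have pow: "(act a ^^ k) g \<in> U" if "a \<in> sl" "g \<in> U" for a g k
      using that by (induction k) (auto intro: inv)
    obtain f where f: "f \<in> U" "f \<noteq> 0"
      using U(3) pm.subspace_0[OF sub] by auto
    define c where "c j = lookup f (Poly_Mapping.single 1 (M - j) + Poly_Mapping.single 2 j)" for j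
    have f_eq: "f = (\<Sum>j\<le>M. pscale (c j) (mon (M - j) j))"
      using mon_expansion U(1) f(1) unfolding c_def by blast
    define K where "K = {j. j \<le> M \<and> c j \<noteq> 0}"
    have K: "finite K" "K \<noteq> {}"
    proof -
      have "f = 0" if "\<forall>j\<le>M. c j = 0"
        unfolding f_eq using that by (auto intro!: sum.neutral)
      with f(2) show "K \<noteq> {}" by (auto simp: K_def)
    qed (simp add: K_def)
    define k where "k = Max K"
    have "k \<in> K" unfolding k_def using K by (rule Max_in)
    then have k: "k \<le> M" "c k \<noteq> 0" by (auto simp: K_def)
    have k_max: "c j = 0" if "j \<le> M" "k < j" for j
      using Max_ge[OF K(1), of j] that by (auto simp: k_def[symmetric] K_def[THEN eqset_imp_iff])
    have "(act raise ^^ k) f = (\<Sum>j\<le>M. pscale (c j) (pscale (of_nat (\<Prod>i<k. j - i)) (mon (M - j + k) (j - k))))"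
      by (subst f_eq) (simp only: act_pow_sum act_raise_pow)
    also have "\<dots> = (\<Sum>j\<le>M. if j = k then pscale (c k * of_nat (\<Prod>i<k. k - i)) (mon M 0) else 0)"
    proof (rule sum.cong)
      fix j assume j: "j \<in> {..M}"
      consider "j < k" | "j = k" | "k < j" by linarith
      then show "pscale (c j) (pscale (of_nat (\<Prod>i<k. j - i)) (mon (M - j + k) (j - k)))
        = (if j = k then pscale (c k * of_nat (\<Prod>i<k. k - i)) (mon M 0) else 0)"
      proof cases
        case 1
        then have "(\<Prod>i<k. j - i) = 0" by (auto intro: prod_zero)
        with 1 show ?thesis by (simp del: of_nat_prod)
      qed (use j k k_max in auto)
    qed simp
    also have "\<dots> = pscale (c k * of_nat (\<Prod>i<k. k - i)) (mon M 0)"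
      using k by simp
    finally have "pscale (c k * of_nat (\<Prod>i<k. k - i)) (mon M 0) \<in> U"
      using pow[OF sl(1) f(1)] by metis
    moreover define e where "e = c k * of_nat (\<Prod>i<k. k - i)"
    ultimately have "pscale (inverse e) (pscale e (mon M 0)) \<in> U"
      using pm.subspace_scale[OF sub] by metis
    moreover have "e \<noteq> 0"
      using k by (auto simp: e_def simp del: of_nat_prod)
    ultimately have top: "mon M 0 \<in> U"
      by simp
    have all: "mon (M - j) j \<in> U" if "j \<le> M" for j
    proof -
      have "pscale (of_nat (\<Prod>i<j. M - i)) (mon (M - j) j) \<in> U"
        using pow[OF sl(2) top, of j] by (simp add: act_lower_pow del: of_nat_prod)
      then have "pscale (inverse (of_nat (\<Prod>i<j. M - i))) (pscale (of_nat (\<Prod>i<j. M - i)) (mon (M - j) j)) \<in> U"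
        by (rule pm.subspace_scale[OF sub])
      moreover have "(\<Prod>i<j. M - i) \<noteq> 0" using that by auto
      ultimately show ?thesis by (simp del: of_nat_prod)
    qed
    have "g \<in> U" if "g \<in> homog M" for g
      by (subst mon_expansion[OF that]) (auto intro!: pm.subspace_sum[OF sub] pm.subspace_scale[OF sub] all)
    with U(1) show ?thesis by auto
  qed
  moreover have "lie_module sl act (homog M :: 2 polynomial set)"
    by (auto intro: lie_module_act subspace_homog act_homog)
  moreover have "(homog M :: 2 polynomial set) \<noteq> {0}"
    using nz mon_homog[of M 0 M] by auto
  ultimately show ?thesis unfolding irreducible_module_def by blast
qed

lemma dim_homog: "pm.dim (homog M :: 2 polynomial set) = M + 1"
proof -
  let ?b = "\<lambda>j. mon (M - j) j"
  have inj: "inj_on ?b {..M}"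
  proof (rule inj_onI)
    fix i j assume "?b i = ?b j"
    then have "lookup (?b i) (Poly_Mapping.single 1 (M - i) + Poly_Mapping.single 2 i)
             = lookup (?b j) (Poly_Mapping.single 1 (M - i) + Poly_Mapping.single 2 i)" by simp
    then show "i = j"
      by (simp add: lookup_mon lookup_add lookup_single when_def split: if_splits)
  qed
  have "pm.independent (?b ` {..M})"
  proof (rule pm.independent_if_scalars_zero)
    fix u x assume u: "(\<Sum>x\<in>?b ` {..M}. pscale (u x) x) = 0" and "x \<in> ?b ` {..M}"
    then obtain i where i: "i \<le> M" "x = ?b i" by auto
    let ?m = "Poly_Mapping.single 1 (M - i) + Poly_Mapping.single 2 i :: 2 \<Rightarrow>\<^sub>0 nat"
    have "0 = lookup (\<Sum>x\<in>?b ` {..M}. pscale (u x) x) ?m" using u by simp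
    also have "\<dots> = (\<Sum>j\<le>M. if j = i then u (?b i) else 0)"
      unfolding sum.reindex[OF inj] lookup_sum
      by (rule sum.cong) (auto simp: lookup_mon lookup_add lookup_single when_def)
    finally show "u x = 0" using i by simp
  qed simp
  moreover have "?b ` {..M} \<subseteq> homog M" by (auto intro: mon_homog)
  moreover have "homog M \<subseteq> pm.span (?b ` {..M})"
  proof
    fix g :: "2 polynomial" assume "g \<in> homog M"
    then show "g \<in> pm.span (?b ` {..M})"
      by (subst mon_expansion) (auto intro!: pm.span_sum pm.span_scale intro: pm.span_base)
  qed
  ultimately show ?thesis
    using pm.dim_unique card_image[OF inj] by (metis card_atMost Suc_eq_plus1)
qed


section \<open>The operators on \<open>\<complex>[x,y,z,w]\<close>\<close>

text \<open>The variables \<open>x, y, z, w\<close> have the indices \<open>1, 2, 3, 4\<close> of type \<^typ>\<open>4\<close> (where \<open>4 = 0\<close>).\<close>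

definition mat_unit :: "4 \<Rightarrow> 4 \<Rightarrow> complex^4^4" where
  "mat_unit a b = (\<chi> r c. if r = a \<and> c = b then 1 else 0)"

text \<open>In each of the following, any index other than 1 and 2 is treated as 3.\<close>

definition A :: "nat \<Rightarrow> complex^4^4" where
  "A i = (if i = 1 then mat_unit 1 2 + mat_unit 2 1 + mat_unit 3 4 + mat_unit 4 3
     else if i = 2 then mat_unit 1 3 + mat_unit 3 1 + mat_unit 2 4 + mat_unit 4 2
     else mat_unit 1 4 + mat_unit 4 1 + mat_unit 2 3 + mat_unit 3 2)"

definition Astar :: "nat \<Rightarrow> complex^4^4" where
  "Astar i = (if i = 1 then mat_unit 1 1 + mat_unit 2 2 - mat_unit 3 3 - mat_unit 4 4
     else if i = 2 then mat_unit 1 1 - mat_unit 2 2 + mat_unit 3 3 - mat_unit 4 4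
     else mat_unit 1 1 - mat_unit 2 2 - mat_unit 3 3 + mat_unit 4 4)"

definition L :: "nat \<Rightarrow> 4 polynomial \<Rightarrow> 4 polynomial" where
  "L i f = (if i = 1 then D 1 (D 2 f) - D 3 (D 4 f)
     else if i = 2 then D 1 (D 3 f) - D 4 (D 2 f)
     else D 1 (D 4 f) - D 2 (D 3 f))"

definition R :: "nat \<Rightarrow> 4 polynomial \<Rightarrow> 4 polynomial" where
  "R i f = (if i = 1 then (var 1 * var 2 - var 3 * var 4) * f
     else if i = 2 then (var 1 * var 3 - var 4 * var 2) * f
     else (var 1 * var 4 - var 2 * var 3) * f)"

definition C :: "nat \<Rightarrow> 4 polynomial \<Rightarrow> 4 polynomial" where
  "C i f = pscale (1/2) (((\<lambda>g. Omega g + pscale 2 g) ^^ 2) f) - L i (R i f) - R i (L i f)"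

definition summand :: "nat \<Rightarrow> nat \<Rightarrow> nat \<Rightarrow> 4 polynomial set" where
  "summand i N l = (R i ^^ l) ` ({f. L i f = 0} \<inter> homog (N - 2 * l))"

definition orthogonal_direct_sum ::
  "'i set \<Rightarrow> ('i \<Rightarrow> ('n::finite) polynomial set) \<Rightarrow> 'n polynomial set \<Rightarrow> bool" where
  "orthogonal_direct_sum I W V \<longleftrightarrow>
     (\<forall>l\<in>I. pm.subspace (W l)) \<and>
     V = {\<Sum>l\<in>I. g l | g. \<forall>l\<in>I. g l \<in> W l} \<and>
     (\<forall>g. (\<forall>l\<in>I. g l \<in> W l) \<and> (\<Sum>l\<in>I. g l) = 0 \<longrightarrow> (\<forall>l\<in>I. g l = 0)) \<and>
     (\<forall>l\<in>I. \<forall>k\<in>I. l \<noteq> k \<longrightarrow> (\<forall>f\<in>W l. \<forall>g\<in>W k. herm f g = 0))"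

definition is_eigenspace ::
  "(('b \<Rightarrow>\<^sub>0 complex) \<Rightarrow> ('b \<Rightarrow>\<^sub>0 complex)) \<Rightarrow> ('b \<Rightarrow>\<^sub>0 complex) set \<Rightarrow> complex \<Rightarrow> ('b \<Rightarrow>\<^sub>0 complex) set \<Rightarrow> bool" where
  "is_eigenspace T V \<theta> W \<longleftrightarrow> W = {f \<in> V. T f = pscale \<theta> f} \<and> W \<noteq> {0}"


section \<open>The Lie subalgebras isomorphic to \<open>\<ss>\<ll>\<^sub>2 \<oplus> \<ss>\<ll>\<^sub>2\<close>\<close>

definition lie_sub :: "nat \<Rightarrow> (complex^4^4) set" where
  "lie_sub i = lie_generated (A ` ({1,2,3} - {i}) \<union> Astar ` ({1,2,3} - {i}))"

definition A0 :: "complex^2^2" where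
  "A0 = (\<chi> r c. if r = c then 0 else 1)"

definition A0star :: "complex^2^2" where
  "A0star = (\<chi> r c. if r = c then (if r = 1 then 1 else -1) else 0)"

text \<open>\<open>\<iota>\<close> is the identification of \<open>\<ss>\<ll>\<^sub>2 \<oplus> \<ss>\<ll>\<^sub>2\<close> with the \<open>i\<close>th subalgebra for a given ordering
  \<open>j, k\<close> of the two other indices. As \<open>A0\<close> and \<open>A0star\<close> generate \<open>\<ss>\<ll>\<^sub>2\<close>, the map \<open>\<iota>\<close> is determined
  on \<open>\<ss>\<ll>\<^sub>2 \<oplus> \<ss>\<ll>\<^sub>2\<close>; exchanging \<open>j\<close> and \<open>k\<close> amounts to exchanging the two direct summands.\<close>

definition lie_identification ::
  "nat \<Rightarrow> nat \<Rightarrow> nat \<Rightarrow> ((complex^2^2) \<times> (complex^2^2) \<Rightarrow> complex^4^4) \<Rightarrow> bool" where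
  "lie_identification i j k \<iota> \<longleftrightarrow>
     bij_betw \<iota> (sl \<times> sl) (lie_sub i) \<and>
     (\<forall>a\<in>sl. \<forall>b\<in>sl. \<forall>a'\<in>sl. \<forall>b'\<in>sl.
        \<iota> (a + a', b + b') = \<iota> (a, b) + \<iota> (a', b') \<and>
        \<iota> (bracket a a', bracket b b') = bracket (\<iota> (a, b)) (\<iota> (a', b'))) \<and>
     (\<forall>c. \<forall>a\<in>sl. \<forall>b\<in>sl. \<iota> (mscale c a, mscale c b) = mscale c (\<iota> (a, b))) \<and>
     \<iota> (A0, 0) = A j \<and> \<iota> (A0star, 0) = Astar k \<and> \<iota> (0, A0) = A k \<and> \<iota> (0, A0star) = Astar j"

end

(*
  Write the quadratic form as the determinant of a 2x2 matrix of variables; sl_2 + sl_2 acts on its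
  columns and rows. L_i and R_i are adjoint and [L_i, R_i] = Omega + 2, so L_i R_i is a nonzero
  scalar on R_i^l (Ker L_i) in each degree; this gives the decomposition by induction on N, its orthogonality, and
  the eigenvalues of C_i, which are distinct.

  If f_m are the coefficients of f and m! is the product of the factorials of the exponents, then
  L_i f = 0 means that m! f_m does not change when the exponent of one diagonal of the matrix is
  moved to the other diagonal. Hence m! f_m depends only on the column and row degrees (u, t) of m,
  and Ker L_i in degree M has a basis indexed by 0 <= u, t <= M. On it the two copies of sl_2 act
  exactly as on pairs of weight vectors of the irreducible module of dimension M + 1.
*)
theory Submission
  imports Defs "HOL-Computational_Algebra.Fundamental_Theorem_Algebra"
begin

section \<open>The Hermitian form and normalized coefficients\<close>

text \<open>The irreducible module \<open>V\<close> in the claim about tensor products is arbitrary,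
  so its structure has to come from irreducibility and dimension alone; hence the work on
  eigenvectors of operators on abstract subspaces. Both sides are compared through one table of
  structure constants, that of the monomials in two variables. The polynomials do not show it at
  once: plain delta functions of a weight \<open>a\<close> have the raising coefficient
  \<open>M - a + 1\<close> where the table has \<open>a\<close>, and the weights
  \<open>a! (M - a)!\<close> correct this.

  The action \<tau> on the tensor space is not given but must be shown to exist. It is transported
  from the polynomials along a linear bijection, so equivariance costs nothing and the work lies in
  the values on pure tensors.

  The three indices \<open>i\<close> and the two orders of \<open>j, k\<close> are six labellings of
  one matrix of variables, treated at once by a locale. Exchanging \<open>j\<close> and
  \<open>k\<close> transposes the matrix.\<close>

definition norm2 :: "('n::finite \<Rightarrow>\<^sub>0 nat) \<Rightarrow> nat" where
  "norm2 m = (\<Prod>b\<in>UNIV. fact (lookup m b))"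

lemma minus_single_add:
  fixes m :: "'n \<Rightarrow>\<^sub>0 nat"
  shows "lookup m b \<noteq> 0 \<Longrightarrow> m - Poly_Mapping.single b 1 + Poly_Mapping.single b 1 = m"
  using pm_minus_single[of m b "m - Poly_Mapping.single b 1"] by simp

lemma norm2_nonzero [simp]: "norm2 m \<noteq> 0"
  by (simp add: norm2_def)

lemma norm2_add_single: "norm2 (m + Poly_Mapping.single b 1) = (lookup m b + 1) * norm2 m"
proof -
  have "norm2 (m + Poly_Mapping.single b 1)
      = fact (lookup m b + 1) * (\<Prod>c\<in>UNIV - {b}. fact (lookup m c))"
    unfolding norm2_def
    by (subst prod.remove[of _ b])
       (auto simp: lookup_add lookup_single when_def intro!: prod.cong)
  also have "\<dots> = (lookup m b + 1) * norm2 m"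
    unfolding norm2_def by (subst (2) prod.remove[of _ b]) (auto simp: algebra_simps)
  finally show ?thesis .
qed

text \<open>In terms of the normalized coefficients, \<open>D b\<close> is a shift and multiplication by a
  variable is a weighted shift.\<close>

definition ncoeff :: "('n::finite) polynomial \<Rightarrow> ('n \<Rightarrow>\<^sub>0 nat) \<Rightarrow> complex" where
  "ncoeff f m = of_nat (norm2 m) * lookup f m"

lemma poly_eqI_ncoeff: "(\<And>m. ncoeff f m = ncoeff g m) \<Longrightarrow> f = g"
  by (intro poly_mapping_eqI) (simp add: ncoeff_def)

lemma ncoeff_zero [simp]: "ncoeff 0 m = 0"
  by (simp add: ncoeff_def)

lemma ncoeff_add [simp]: "ncoeff (f + g) m = ncoeff f m + ncoeff g m"
  by (simp add: ncoeff_def lookup_add algebra_simps)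

lemma ncoeff_diff [simp]: "ncoeff (f - g) m = ncoeff f m - ncoeff g m"
  by (simp add: ncoeff_def lookup_minus algebra_simps)

lemma ncoeff_pscale [simp]: "ncoeff (pscale c f) m = c * ncoeff f m"
  by (simp add: ncoeff_def)

lemma ncoeff_sum: "ncoeff (\<Sum>x\<in>S. f x) m = (\<Sum>x\<in>S. ncoeff (f x) m)"
  by (induction S rule: infinite_finite_induct) auto

lemma ncoeff_D: "ncoeff (D b f) m = ncoeff f (m + Poly_Mapping.single b 1)"
  by (simp add: ncoeff_def lookup_D norm2_add_single[simplified] algebra_simps)

lemma lookup_var_mult:
  "lookup (var a * f) m = (if lookup m a = 0 then 0 else lookup f (m - Poly_Mapping.single a 1))"
proof (induction f rule: poly_mapping_induct)
  case (single k c)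
  have "Poly_Mapping.single a 1 + k = m \<longleftrightarrow> lookup m a \<noteq> 0 \<and> k = m - Poly_Mapping.single a 1"
    using pm_minus_single[of m a k] by (auto simp: lookup_add add.commute)
  then show ?case
    by (auto simp: var_def mult_single lookup_single when_def)
qed (simp add: distrib_left lookup_add)

lemma ncoeff_var_mult:
  "ncoeff (var a * f) m = of_nat (lookup m a) * ncoeff f (m - Poly_Mapping.single a 1)"
proof (cases "lookup m a = 0")
  case False
  then have m: "m = (m - Poly_Mapping.single a 1) + Poly_Mapping.single a 1"
    by (rule minus_single_add[symmetric])
  have "norm2 m = lookup m a * norm2 (m - Poly_Mapping.single a 1)"
    using False by (subst m) (simp only: norm2_add_single, simp add: lookup_minus)
  with False show ?thesis
    by (simp add: ncoeff_def lookup_var_mult)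
qed (simp add: ncoeff_def lookup_var_mult)

lemma ncoeff_act:
  "ncoeff (act \<phi> f) m = (\<Sum>b\<in>UNIV. \<Sum>a\<in>UNIV. \<phi> $ a $ b * of_nat (lookup m a) *
     ncoeff f (m - Poly_Mapping.single a 1 + Poly_Mapping.single b 1))"
  by (simp add: act_def ncoeff_sum sum_distrib_right pscale_mult ncoeff_var_mult ncoeff_D mult.assoc)

lemma ncoeff_homog: "f \<in> homog N \<longleftrightarrow> (\<forall>m. mdeg m \<noteq> N \<longrightarrow> ncoeff f m = 0)"
  by (auto simp: homog_def ncoeff_def in_keys_iff)

lemma mdeg_add: "mdeg (m + n) = mdeg m + mdeg n"
  by (simp add: mdeg_def lookup_add sum.distrib)

lemma mdeg_single [simp]: "mdeg (Poly_Mapping.single b k) = k"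
  by (simp add: mdeg_def lookup_single when_def)

lemma mdeg_minus_single: "lookup m b \<noteq> 0 \<Longrightarrow> mdeg (m - Poly_Mapping.single b 1) = mdeg m - 1"
  by (metis add_diff_cancel_right' mdeg_add mdeg_single minus_single_add)

text \<open>Ensures that a coefficient function cut off at one degree has finite support, so that
  \<open>Abs_poly_mapping\<close> yields a polynomial with it.\<close>

lemma finite_mdeg: "finite {m :: 'n::finite \<Rightarrow>\<^sub>0 nat. mdeg m = N}"
proof (induction N)
  case 0
  have "{m :: 'n \<Rightarrow>\<^sub>0 nat. mdeg m = 0} \<subseteq> {0}"
    by (auto simp: mdeg_def intro!: poly_mapping_eqI)
  then show ?case using finite_subset by blast
next
  case (Suc N)
  have "{m :: 'n \<Rightarrow>\<^sub>0 nat. mdeg m = Suc N}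
      \<subseteq> (\<Union>b. (\<lambda>m. m + Poly_Mapping.single b 1) ` {m. mdeg m = N})"
  proof
    fix m :: "'n \<Rightarrow>\<^sub>0 nat" assume "m \<in> {m. mdeg m = Suc N}"
    then have m: "mdeg m = Suc N" by simp
    then obtain b where b: "lookup m b \<noteq> 0" by (force simp: mdeg_def)
    then have "m = (m - Poly_Mapping.single b 1) + Poly_Mapping.single b 1"
      by (rule minus_single_add[symmetric])
    moreover have "mdeg (m - Poly_Mapping.single b 1) = N"
      using mdeg_minus_single[OF b] m by simp
    ultimately show "m \<in> (\<Union>b. (\<lambda>m. m + Poly_Mapping.single b 1) ` {m. mdeg m = N})" by blast
  qed
  then show ?case by (rule finite_subset) (simp add: Suc)
qed

text \<open>The truncated \<open>N - 1\<close> is harmless at \<open>N = 0\<close>, where the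
  derivative is zero.\<close>

lemma D_homog: "f \<in> homog N \<Longrightarrow> D b f \<in> homog (N - 1)"
  by (auto simp: ncoeff_homog ncoeff_D mdeg_add)

lemma var_mult_homog:
  fixes f :: "('n::finite) polynomial"
  assumes "f \<in> homog N"
  shows "var b * f \<in> homog (Suc N)"
  unfolding ncoeff_homog
proof (intro allI impI)
  fix m :: "'n \<Rightarrow>\<^sub>0 nat"
  assume "mdeg m \<noteq> Suc N"
  show "ncoeff (var b * f) m = 0"
  proof (cases "lookup m b = 0")
    case False
    then have "m = (m - Poly_Mapping.single b 1) + Poly_Mapping.single b 1"
      by (rule minus_single_add[symmetric])
    then have "mdeg m = mdeg (m - Poly_Mapping.single b 1) + 1"
      by (metis mdeg_add mdeg_single)
    with \<open>mdeg m \<noteq> Suc N\<close> assms show ?thesis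
      by (simp add: ncoeff_var_mult ncoeff_homog)
  qed (simp add: ncoeff_var_mult)
qed

text \<open>Euler's identity; it puts the degree into the commutator of the Laplacian with
  multiplication by the quadratic form.\<close>

lemma euler_homog:
  assumes "f \<in> homog N"
  shows "(\<Sum>b\<in>UNIV. var b * D b f) = pscale (of_nat N) f"
proof (rule poly_eqI_ncoeff)
  fix m
  have "ncoeff (var b * D b f) m = of_nat (lookup m b) * ncoeff f m" for b
    using minus_single_add[of m b]
    by (cases "lookup m b = 0") (auto simp: ncoeff_var_mult ncoeff_D)
  then have "ncoeff (\<Sum>b\<in>UNIV. var b * D b f) m = of_nat (mdeg m) * ncoeff f m"
    by (simp add: ncoeff_sum mdeg_def sum_distrib_right)
  also have "\<dots> = ncoeff (pscale (of_nat N) f) m"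
    using assms by (cases "mdeg m = N") (auto simp: ncoeff_homog)
  finally show "ncoeff (\<Sum>b\<in>UNIV. var b * D b f) m = ncoeff (pscale (of_nat N) f) m" .
qed

section \<open>Definiteness and adjoints for the Hermitian form\<close>

lemma herm_superset:
  assumes "finite S" "keys f \<subseteq> S"
  shows "herm f g = (\<Sum>m\<in>S. lookup f m * cnj (lookup g m) * of_nat (norm2 m))"
  unfolding herm_def norm2_def using assms
  by (intro sum.mono_neutral_left) (auto simp: in_keys_iff)

lemma herm_add_left: "herm (f + g) h = herm f h + herm g h"
proof -
  have "finite (keys f \<union> keys g)" "keys (f + g) \<subseteq> keys f \<union> keys g"
    by (auto simp: keys_add)
  then show ?thesis
    by (simp add: herm_superset[of "keys f \<union> keys g"] lookup_add sum.distrib algebra_simps)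
qed

lemma herm_cnj: "herm g f = cnj (herm f g)"
  by (simp add: herm_superset[of "keys f \<union> keys g"] algebra_simps)

lemma herm_add_right: "herm h (f + g) = herm h f + herm h g"
  by (metis complex_cnj_add herm_add_left herm_cnj)

lemma herm_zero [simp]: "herm 0 g = 0" "herm g 0 = 0"
  by (simp_all add: herm_def)

lemma herm_diff_left: "herm (f - g) h = herm f h - herm g h"
  using herm_add_left[of "f - g" g h] by simp

lemma herm_diff_right: "herm h (f - g) = herm h f - herm h g"
  using herm_add_right[of h "f - g" g] by simp

lemma herm_sum_right: "herm h (\<Sum>x\<in>S. f x) = (\<Sum>x\<in>S. herm h (f x))"
  by (induction S rule: infinite_finite_induct) (auto simp: herm_add_right)

lemma herm_definite:
  assumes "herm f f = 0"
  shows "f = 0"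
proof -
  have "herm f f = of_real (\<Sum>m\<in>keys f. (cmod (lookup f m))\<^sup>2 * real (norm2 m))"
    by (simp add: herm_superset[of "keys f"] complex_norm_square[symmetric])
  with assms have "(\<Sum>m\<in>keys f. (cmod (lookup f m))\<^sup>2 * real (norm2 m)) = 0"
    by (metis of_real_eq_0_iff)
  then have "\<forall>m\<in>keys f. (cmod (lookup f m))\<^sup>2 * real (norm2 m) = 0"
    by (subst (asm) sum_nonneg_eq_0_iff) auto
  then show ?thesis
    by (auto intro!: poly_mapping_eqI simp: in_keys_iff)
qed

text \<open>The purpose of the factorial weights: raising the exponent of \<open>a\<close>
  multiplies \<open>norm2\<close> by exactly the factor that \<open>D a\<close> produces.\<close>

lemma herm_var_mult: "herm (var a * f) g = herm f (D a g)"
proof (induction f rule: poly_mapping_induct)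
  case (single m c)
  have "herm (Poly_Mapping.single k c) h = c * cnj (lookup h k) * of_nat (norm2 k)"
    for k :: "'a \<Rightarrow>\<^sub>0 nat" and h
    by (simp add: herm_superset[of "{k}"])
  moreover have "var a * Poly_Mapping.single m c = Poly_Mapping.single (m + Poly_Mapping.single a 1) c"
    by (simp add: var_def mult_single add.commute)
  ultimately show ?case
    by (simp add: lookup_D norm2_add_single[simplified] algebra_simps)
qed (simp add: herm_add_left distrib_left)

section \<open>Laplacian and quadratic form\<close>

lemma D_minus: "D b (f - g) = D b f - D b g"
  using D_add[of b "f - g" g] by simp

lemma D_0: "D b 0 = 0"
  by (simp add: D_def)

lemma D_1: "D b 1 = 0"
  by (simp add: single_one[symmetric] D_single del: single_one)

text \<open>Arranging the variables in the matrix with rows \<open>p, r\<close> and \<open>s, q\<close>, the quadratic form is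
  the determinant. The two factors of \<open>\<ss>\<ll>\<^sub>2 \<oplus> \<ss>\<ll>\<^sub>2\<close> act on its columns and on its rows.\<close>

locale quadric =
  fixes p q r s :: "'n::finite"
  assumes univ: "(UNIV :: 'n set) = {p, q, r, s}" and distinct: "distinct [p, q, r, s]"
begin

lemma neqs [simp]: "p \<noteq> q" "q \<noteq> p" "p \<noteq> r" "r \<noteq> p" "p \<noteq> s" "s \<noteq> p" "q \<noteq> r" "r \<noteq> q" "q \<noteq> s" "s \<noteq> q"
  "r \<noteq> s" "s \<noteq> r"
  using distinct by auto

lemma sum_univ: "(\<Sum>b\<in>UNIV. g b) = g p + g q + g r + (g s :: 'z::ab_group_add)"
  by (simp add: univ add_ac)

lemma mdeg_eq: "mdeg (m :: 'n \<Rightarrow>\<^sub>0 nat) = lookup m p + lookup m q + lookup m r + lookup m s"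
  by (simp add: mdeg_def univ)

lemma exponent_eqI:
  "lookup m p = lookup n p \<Longrightarrow> lookup m q = lookup n q \<Longrightarrow> lookup m r = lookup n r
    \<Longrightarrow> lookup m s = lookup n s \<Longrightarrow> m = (n :: 'n \<Rightarrow>\<^sub>0 nat)"
  using univ by (intro poly_mapping_eqI) auto

definition laplace :: "'n polynomial \<Rightarrow> 'n polynomial" where
  "laplace f = D p (D q f) - D r (D s f)"

definition qform :: "'n polynomial" where
  "qform = var p * var q - var r * var s"

definition qmult :: "'n polynomial \<Rightarrow> 'n polynomial" where
  "qmult f = qform * f"

definition harmonic :: "nat \<Rightarrow> 'n polynomial set" where
  "harmonic M = {f. laplace f = 0} \<inter> homog M"

lemma laplace_add: "laplace (f + g) = laplace f + laplace g"
  by (simp add: laplace_def D_add)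

lemma laplace_pscale: "laplace (pscale c f) = pscale c (laplace f)"
  by (simp add: laplace_def D_pscale pm.scale_right_diff_distrib)

lemma laplace_0: "laplace 0 = 0"
  by (simp add: laplace_def D_0)

lemma qmult_add: "qmult (f + g) = qmult f + qmult g"
  by (simp add: qmult_def algebra_simps)

lemma qmult_pscale: "qmult (pscale c f) = pscale c (qmult f)"
  by (simp add: qmult_def pscale_mult)

lemma qmult_pow_add: "(qmult ^^ l) (f + g) = (qmult ^^ l) f + (qmult ^^ l) g"
  by (induction l) (simp_all add: qmult_add)

lemma qmult_pow_pscale: "(qmult ^^ l) (pscale c f) = pscale c ((qmult ^^ l) f)"
  by (induction l) (simp_all add: qmult_pscale)

lemma laplace_sum: "laplace (\<Sum>x\<in>S. g x) = (\<Sum>x\<in>S. laplace (g x))"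
  by (induction S rule: infinite_finite_induct) (auto simp: laplace_0 laplace_add)

lemma qmult_0: "qmult 0 = 0"
  by (simp add: qmult_def)

lemma laplace_homog: "f \<in> homog N \<Longrightarrow> laplace f \<in> homog (N - 2)"
  unfolding laplace_def
  by (intro pm.subspace_diff[OF subspace_homog])
     (metis D_homog diff_diff_left one_add_one)+

lemma qmult_homog: "f \<in> homog N \<Longrightarrow> qmult f \<in> homog (N + 2)"
  unfolding qmult_def qform_def left_diff_distrib mult.assoc
  by (intro pm.subspace_diff[OF subspace_homog]) (simp_all add: var_mult_homog numeral_2_eq_2)

lemma herm_qmult: "herm (qmult f) g = herm f (laplace g)"
  by (simp add: qmult_def qform_def laplace_def left_diff_distrib mult.assoc herm_diff_left
      herm_diff_right herm_var_mult D_commute[of q p] D_commute[of s r])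

text \<open>Second-order product rule: the terms with one derivative on \<open>qform\<close> add up
  to the Euler operator, and those with both derivatives on it give one copy of \<open>f\<close> for
  each of the two products of variables.\<close>

lemma laplace_qmult:
  assumes "f \<in> homog N"
  shows "laplace (qmult f) = qmult (laplace f) + pscale (of_nat (N + 2)) f"
proof -
  have "laplace (qmult f) = qmult (laplace f) + ((\<Sum>b\<in>UNIV. var b * D b f) + f + f)"
    by (simp add: sum_univ laplace_def qmult_def qform_def D_minus D_mult D_var D_add
        D_0 D_1 algebra_simps)
  also have "\<dots> = qmult (laplace f) + pscale (of_nat (N + 2)) f"
    using assms pm.scale_left_distrib[of 1 1 f]
    by (simp add: euler_homog pm.scale_left_distrib add.assoc)
  finally show ?thesis .
qed

lemma qmult_pow_homog: "f \<in> homog N \<Longrightarrow> (qmult ^^ l) f \<in> homog (N + 2 * l)"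
  by (induction l) (auto dest: qmult_homog)

lemma harmonic_laplace: "f \<in> harmonic M \<Longrightarrow> laplace f = 0"
  and harmonic_homog: "f \<in> harmonic M \<Longrightarrow> f \<in> homog M"
  by (auto simp: harmonic_def)

lemma subspace_harmonic: "pm.subspace (harmonic M)"
proof -
  have "pm.subspace {f. laplace f = 0}"
    by (simp add: pm.subspace_def laplace_add laplace_pscale laplace_0)
  then show ?thesis
    unfolding harmonic_def by (intro pm.subspace_inter subspace_homog)
qed

text \<open>Passing \<open>laplace\<close> through the factors \<open>qmult\<close> contributes
  \<open>M + 2 * j + 2\<close> for each \<open>j \<le> l\<close>, and these numbers add up to
  \<open>(l + 1) * (M + l + 2)\<close>. The scalar is never zero; injectivity and the decomposition
  rest on this.\<close>

lemma laplace_qmult_pow: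
  assumes "f \<in> harmonic M"
  shows "laplace ((qmult ^^ Suc l) f) = pscale (of_nat ((l + 1) * (M + l + 2))) ((qmult ^^ l) f)"
proof (induction l)
  case 0
  show ?case
    using laplace_qmult[OF harmonic_homog[OF assms]] harmonic_laplace[OF assms]
    by (simp add: qmult_0)
next
  case (Suc l)
  have "laplace ((qmult ^^ Suc (Suc l)) f)
      = pscale (of_nat ((l + 1) * (M + l + 2)) + of_nat (M + 2 * Suc l + 2)) ((qmult ^^ Suc l) f)"
    using laplace_qmult[OF qmult_pow_homog[OF harmonic_homog[OF assms], of "Suc l"]] Suc
    by (simp only: funpow.simps comp_apply qmult_pscale pm.scale_left_distrib)
  also have "of_nat ((l + 1) * (M + l + 2)) + of_nat (M + 2 * Suc l + 2)
      = (of_nat ((Suc l + 1) * (M + Suc l + 2)) :: complex)"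
    unfolding of_nat_add[symmetric] by (rule arg_cong[of _ _ of_nat]) (simp add: algebra_simps)
  finally show ?case .
qed

lemma qmult_inj: "f \<in> harmonic M \<Longrightarrow> (qmult ^^ l) f = 0 \<Longrightarrow> f = 0"
proof (induction l)
  case (Suc l)
  then have "pscale (of_nat ((l + 1) * (M + l + 2))) ((qmult ^^ l) f) = 0"
    using laplace_qmult_pow[OF Suc(2), of l] by (simp only: laplace_0)
  with Suc show ?case
    by (simp only: pm.scale_eq_0_iff of_nat_eq_0_iff) simp
qed simp

lemma laplace_pow_qmult_pow:
  assumes "f \<in> harmonic M" "k < l"
  shows "(laplace ^^ l) ((qmult ^^ k) f) = 0"
proof -
  have scale: "(laplace ^^ n) (pscale c g) = pscale c ((laplace ^^ n) g)" for n c g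
    by (induction n) (simp_all add: laplace_pscale)
  have zero: "(laplace ^^ n) 0 = 0" for n
    by (induction n) (simp_all add: laplace_0)
  from assms(2) show ?thesis
  proof (induction k arbitrary: l)
    case 0
    then show ?case
      using harmonic_laplace[OF assms(1)] zero by (cases l) (simp_all add: funpow_Suc_right del: funpow.simps)
  next
    case (Suc k)
    then obtain l' where "l = Suc l'" "k < l'" by (cases l) auto
    have "(laplace ^^ l) ((qmult ^^ Suc k) f) = (laplace ^^ l') (laplace ((qmult ^^ Suc k) f))"
      by (simp only: \<open>l = Suc l'\<close> funpow_Suc_right[of l' laplace] comp_apply)
    then show ?case
      using Suc \<open>k < l'\<close> by (simp only: scale laplace_qmult_pow[OF assms(1)] pm.scale_zero_right)
  qed
qed

lemma herm_qmult_pow: "herm ((qmult ^^ l) f) g = herm f ((laplace ^^ l) g)"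
  by (induction l arbitrary: g) (simp_all add: herm_qmult funpow_swap1[of laplace])

text \<open>Moved to the other side, the larger power of \<open>qmult\<close> becomes more
  Laplacians than the smaller power survives. The symmetry of \<open>herm\<close> covers both orders
  of \<open>l\<close> and \<open>k\<close>.\<close>

lemma herm_qmult_pow_harmonic:
  assumes "f \<in> harmonic M" "g \<in> harmonic M'" "l \<noteq> k"
  shows "herm ((qmult ^^ l) f) ((qmult ^^ k) g) = 0"
proof -
  have "herm ((qmult ^^ l) f) ((qmult ^^ k) g) = 0"
    if "k < l" "g \<in> harmonic M'" for f g M' l k
    unfolding herm_qmult_pow laplace_pow_qmult_pow[OF that(2,1)] by simp
  then show ?thesis
    using assms herm_cnj by (metis complex_cnj_zero linorder_neqE_nat)
qed

section \<open>Decomposition into powers of the quadratic form times harmonic polynomials\<close>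

definition component :: "nat \<Rightarrow> nat \<Rightarrow> 'n polynomial set" where
  "component N l = (qmult ^^ l) ` harmonic (N - 2 * l)"

lemma component_homog: "l \<le> N div 2 \<Longrightarrow> component N l \<subseteq> homog N"
  using qmult_pow_homog[of _ "N - 2 * l" l] harmonic_homog[of _ "N - 2 * l"]
  by (fastforce simp: component_def)

lemma subspace_component: "pm.subspace (component N l)"
proof (rule pm.subspaceI)
  show "0 \<in> component N l"
    unfolding component_def using pm.subspace_0[OF subspace_harmonic] qmult_pow_pscale[of l 0 0]
    by (auto intro!: image_eqI[of _ _ 0])
  show "x + y \<in> component N l" if "x \<in> component N l" "y \<in> component N l" for x y
    using that pm.subspace_add[OF subspace_harmonic]
    unfolding component_def by (force simp: qmult_pow_add[symmetric])
  show "pscale c x \<in> component N l" if "x \<in> component N l" for c x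
    using that pm.subspace_scale[OF subspace_harmonic]
    unfolding component_def by (force simp: qmult_pow_pscale[symmetric])
qed

text \<open>On each component \<open>laplace \<circ> qmult\<close> is a nonzero scalar, so some \<open>h\<close> of degree \<open>N\<close> satisfies
  \<open>laplace (qmult h) = laplace f\<close>, and \<open>f - qmult h\<close> is harmonic.\<close>

lemma component_decomposition:
  "f \<in> homog N \<Longrightarrow> \<exists>g. (\<forall>l\<le>N div 2. g l \<in> component N l) \<and> f = (\<Sum>l\<le>N div 2. g l)"
proof (induction N arbitrary: f rule: less_induct)
  case (less N)
  show ?case
  proof (cases "N < 2")
    case True
    have "laplace f = 0"
      using less.prems True
      by (intro poly_eqI_ncoeff) (auto simp: laplace_def ncoeff_D ncoeff_homog mdeg_add)
    then have "f \<in> component N 0"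
      using less.prems by (simp add: component_def harmonic_def)
    with True show ?thesis by (intro exI[of _ "\<lambda>_. f"]) auto
  next
    case False
    then obtain K where N: "N = Suc (Suc K)" by (metis add_2_eq_Suc le_Suc_ex not_less)
    have "laplace f \<in> homog K" using laplace_homog[OF less.prems] N by simp
    then obtain g where g: "\<And>l. l \<le> K div 2 \<Longrightarrow> g l \<in> component K l"
      and f: "laplace f = (\<Sum>l\<le>K div 2. g l)"
      using less.IH[of K] N by auto
    have "\<exists>h. h \<in> harmonic (K - 2 * l) \<and> g l = (qmult ^^ l) h" if "l \<le> K div 2" for l
      using g[OF that] by (auto simp: component_def)
    then obtain h where h: "\<And>l. l \<le> K div 2 \<Longrightarrow> h l \<in> harmonic (K - 2 * l)"
      "\<And>l. l \<le> K div 2 \<Longrightarrow> g l = (qmult ^^ l) (h l)" by metis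
    \<comment> \<open>The scalar of \<open>laplace_qmult_pow\<close> in harmonic degree
      \<open>K - 2 * l\<close>. This degree is also \<open>N - 2 * Suc l\<close>, so one more factor
      \<open>qmult\<close> leads into \<open>component N (Suc l)\<close>.\<close>
    define c where "c l = (of_nat ((l + 1) * (K - 2 * l + l + 2)) :: complex)" for l
    have c: "c l \<noteq> 0" for l unfolding c_def of_nat_eq_0_iff by simp
    define g' where "g' l = pscale (inverse (c l)) ((qmult ^^ Suc l) (h l))" for l
    have g': "g' l \<in> component N (Suc l)" if "l \<le> K div 2" for l
    proof -
      have "(qmult ^^ Suc l) (h l) \<in> component N (Suc l)"
        unfolding component_def N using h(1)[OF that] by (intro imageI) simp
      then show ?thesis unfolding g'_def by (rule pm.subspace_scale[OF subspace_component])
    qed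
    have "laplace (g' l) = g l" if "l \<le> K div 2" for l
      unfolding g'_def laplace_pscale laplace_qmult_pow[OF h(1)[OF that]] c_def[symmetric]
      using c h(2)[OF that] by simp
    then have "laplace (f - (\<Sum>l\<le>K div 2. g' l)) = 0"
      using laplace_add[of "f - (\<Sum>l\<le>K div 2. g' l)" "\<Sum>l\<le>K div 2. g' l"]
      by (simp add: f laplace_sum)
    moreover have "g' l \<in> homog N" if "l \<le> K div 2" for l
      using g'[OF that] component_homog[of "Suc l" N] that N by auto
    ultimately have "f - (\<Sum>l\<le>K div 2. g' l) \<in> component N 0"
      using less.prems unfolding component_def harmonic_def
      by (auto intro!: pm.subspace_diff[OF subspace_homog] pm.subspace_sum[OF subspace_homog])
    moreover have "N div 2 = Suc (K div 2)" using N by simp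
    \<comment> \<open>Index 0 takes the harmonic remainder, and the corrections move up by
      one.\<close>
    ultimately show ?thesis
      using g' by (intro exI[of _ "\<lambda>l. case l of 0 \<Rightarrow> f - (\<Sum>l\<le>K div 2. g' l) | Suc l \<Rightarrow> g' l"])
        (auto simp: sum.atMost_Suc_shift simp del: sum.atMost_Suc split: nat.split)
  qed
qed

lemma component_orthogonal:
  "f \<in> component N l \<Longrightarrow> g \<in> component N k \<Longrightarrow> l \<noteq> k \<Longrightarrow> herm f g = 0"
  by (auto simp: component_def intro: herm_qmult_pow_harmonic)

text \<open>Pairing the sum with \<open>g l\<close> leaves only \<open>herm (g l) (g l)\<close>, and
  the form is definite.\<close>

lemma component_independent:
  assumes g: "\<forall>l\<in>I. g l \<in> component N l" and "finite I" "(\<Sum>l\<in>I. g l) = 0"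
  shows "\<forall>l\<in>I. g l = 0"
proof
  fix l assume l: "l \<in> I"
  have "0 = herm (g l) (\<Sum>k\<in>I. g k)" using assms by simp
  also have "\<dots> = (\<Sum>k\<in>I. if k = l then herm (g l) (g l) else 0)"
    unfolding herm_sum_right using g l
    by (intro sum.cong) (auto intro!: component_orthogonal[of "g l" N l])
  also have "\<dots> = herm (g l) (g l)" using l \<open>finite I\<close> by simp
  finally show "g l = 0" by (intro herm_definite) simp
qed

lemma orthogonal_direct_sum_component:
  "orthogonal_direct_sum {..N div 2} (component N) (homog N)"
proof -
  have "(\<Sum>l\<le>N div 2. g l) \<in> homog N" if "\<forall>l\<le>N div 2. g l \<in> component N l" for g
    using that component_homog by (intro pm.subspace_sum[OF subspace_homog]) blast
  then have "homog N = {\<Sum>l\<le>N div 2. g l | g. \<forall>l\<le>N div 2. g l \<in> component N l}"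
    using component_decomposition by blast
  then show ?thesis
    using component_orthogonal component_independent[of "{..N div 2}"]
    by (auto simp: orthogonal_direct_sum_def subspace_component)
qed

section \<open>Eigenvalues of the Casimir operator\<close>

definition casimir :: "'n polynomial \<Rightarrow> 'n polynomial" where
  "casimir f = pscale (1/2) (((\<lambda>g. Omega g + pscale 2 g) ^^ 2) f) - laplace (qmult f) - qmult (laplace f)"

lemma casimir_component:
  assumes "f \<in> component N l" "l \<le> N div 2"
  shows "casimir f = pscale (of_nat ((N - 2 * l) * (N - 2 * l + 2)) / 2) f"
proof -
  define M where "M = N - 2 * l"
  have N: "N = M + 2 * l" using assms(2) by (simp add: M_def)
  obtain h where h: "h \<in> harmonic M" "f = (qmult ^^ l) h"
    using assms(1) by (auto simp: component_def M_def)
  have "f \<in> homog N" using assms component_homog by blast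
  then have "pscale (of_nat N + 2) f \<in> homog N"
    by (rule pm.subspace_scale[OF subspace_homog])
  moreover have "Omega g + pscale 2 g = pscale (of_nat N + 2) g" if "g \<in> homog N" for g :: "'n polynomial"
    using that by (simp add: Omega_homog pm.scale_left_distrib)
  ultimately have "((\<lambda>g. Omega g + pscale 2 g) ^^ 2) f = pscale (of_nat N + 2) (pscale (of_nat N + 2) f)"
    using \<open>f \<in> homog N\<close> by (simp only: numeral_2_eq_2 funpow.simps comp_apply id_apply)
  then have omega: "((\<lambda>g. Omega g + pscale 2 g) ^^ 2) f = pscale ((of_nat N + 2)\<^sup>2) f"
    by (simp only: pm.scale_scale power2_eq_square)
  have lr: "laplace (qmult f) = pscale (of_nat ((l + 1) * (M + l + 2))) f"
    using laplace_qmult_pow[OF h(1), of l] h(2) by simp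
  \<comment> \<open>This is \<open>laplace_qmult_pow\<close> one power lower, so
    \<open>l = 0\<close> needs its own case: there \<open>laplace\<close> kills
    \<open>f\<close>.\<close>
  have rl: "qmult (laplace f) = pscale (of_nat (l * (M + l + 1))) f"
  proof (cases l)
    case 0
    then show ?thesis using h harmonic_laplace by (simp add: qmult_0)
  next
    case (Suc l')
    then show ?thesis
      unfolding h(2) Suc laplace_qmult_pow[OF h(1)] qmult_pscale by simp
  qed
  have "casimir f = pscale ((of_nat N + 2)\<^sup>2 / 2 - of_nat ((l + 1) * (M + l + 2)) - of_nat (l * (M + l + 1))) f"
    unfolding casimir_def omega lr rl
    by (simp only: pm.scale_left_diff_distrib pm.scale_scale times_divide_eq_left mult_1)
  \<comment> \<open>All terms containing \<open>l\<close> cancel, and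
    \<open>(M + 2)^2 / 2 - (M + 2)\<close> remains.\<close>
  also have "(of_nat N + 2)\<^sup>2 / 2 - of_nat ((l + 1) * (M + l + 2)) - of_nat (l * (M + l + 1))
      = (of_nat (M * (M + 2)) / 2 :: complex)"
    by (simp add: N power2_eq_square field_simps)
  finally show ?thesis by (simp add: M_def)
qed

end

section \<open>Irreducible modules of \<open>\<ss>\<ll>\<^sub>2\<close>\<close>

text \<open>The normalization of binary forms: \<open>v c\<close> behaves like the monomial \<open>mon (M - c) c\<close>.
  The junk vectors \<open>v (0 - 1)\<close> and \<open>v (M + 1)\<close> occur with coefficient zero.\<close>

definition standard_basis ::
  "(complex^2^2 \<Rightarrow> ('b \<Rightarrow>\<^sub>0 complex) \<Rightarrow> ('b \<Rightarrow>\<^sub>0 complex)) \<Rightarrow> ('b \<Rightarrow>\<^sub>0 complex) set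
     \<Rightarrow> nat \<Rightarrow> (nat \<Rightarrow> ('b \<Rightarrow>\<^sub>0 complex)) \<Rightarrow> bool" where
  "standard_basis \<rho> V M v \<longleftrightarrow>
     pm.independent (v ` {..M}) \<and> inj_on v {..M} \<and> pm.span (v ` {..M}) = V \<and>
     (\<forall>a\<in>sl. \<forall>c\<le>M. \<rho> a (v c) = pscale (a$1$1 * (of_nat M - 2 * of_nat c)) (v c)
        + pscale (a$1$2 * of_nat c) (v (c - 1)) + pscale (a$2$1 * of_nat (M - c)) (v (Suc c)))"

lemma sl2_22: "a \<in> sl \<Longrightarrow> (a :: complex^2^2)$2$2 = - a$1$1"
  by (simp add: sl_def trace_def sum_2 eq_neg_iff_add_eq_0 add.commute)

lemma sl2_expand:
  assumes "a \<in> sl"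
  shows "(a :: complex^2^2) = mscale (a$1$1) A0star + (mscale (a$1$2) raise + mscale (a$2$1) lower)"
  using sl2_22[OF assms]
  by (simp add: vec_eq_iff forall_2 mscale_def A0star_def raise_def lower_def)

lemma sl2_in_sl: "A0star \<in> sl" "raise \<in> sl" "lower \<in> sl"
  by (simp_all add: sl_def trace_def A0star_def raise_def lower_def sum_2)

lemma sl_add: "a \<in> sl \<Longrightarrow> b \<in> sl \<Longrightarrow> a + b \<in> sl"
  by (simp add: sl_def trace_add)

lemma sl_mscale: "a \<in> sl \<Longrightarrow> mscale c a \<in> sl"
  by (simp add: sl_def trace_def mscale_def sum_distrib_left[symmetric])

lemma sl_bracket: "bracket a b \<in> sl"
  by (simp add: sl_def bracket_def trace_sub trace_mul_sym[of a b])

lemma sl_zero: "0 \<in> sl"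
  by (simp add: sl_def trace_def)

lemma sl2_brackets:
  "bracket A0star raise = mscale 2 raise" "bracket A0star lower = mscale (-2) lower"
  "bracket raise lower = A0star"
  by (simp_all add: bracket_def matrix_matrix_mult_def vec_eq_iff forall_2 sum_2 mscale_def
      A0star_def raise_def lower_def)

text \<open>An element of the Lie algebra is known to be linear on \<open>V\<close> only. Spans,
  sums and polynomials in \<open>T\<close> are therefore handled with explicit membership in
  \<open>V\<close>.\<close>

locale linear_operator_on =
  fixes V :: "('b \<Rightarrow>\<^sub>0 complex) set" and T :: "('b \<Rightarrow>\<^sub>0 complex) \<Rightarrow> ('b \<Rightarrow>\<^sub>0 complex)"
  assumes subspace: "pm.subspace V"
    and linear: "linear_map_on V T"
    and invariant: "T ` V \<subseteq> V"
begin

lemma closed: "u \<in> V \<Longrightarrow> T u \<in> V"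
  using invariant by auto

lemma add: "u \<in> V \<Longrightarrow> v \<in> V \<Longrightarrow> T (u + v) = T u + T v"
  and scale: "v \<in> V \<Longrightarrow> T (pscale c v) = pscale c (T v)"
  using linear by (auto simp: linear_map_on_def)

lemma zero: "T 0 = 0"
  using scale[of 0 0] pm.subspace_0[OF subspace] by simp

lemma sum: "(\<And>x. x \<in> S \<Longrightarrow> g x \<in> V) \<Longrightarrow> T (\<Sum>x\<in>S. g x) = (\<Sum>x\<in>S. T (g x))"
proof (induction S rule: infinite_finite_induct)
  case (insert x S)
  then have "(\<Sum>x\<in>S. g x) \<in> V" by (intro pm.subspace_sum[OF subspace]) auto
  with insert show ?case by (simp add: add)
qed (simp_all add: zero)

lemma span_image:
  assumes "S \<subseteq> V" "\<And>s. s \<in> S \<Longrightarrow> T s \<in> W" "pm.subspace W" "u \<in> pm.span S"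
  shows "T u \<in> W"
proof -
  have "pm.subspace {u \<in> V. T u \<in> W}"
    using subspace assms(3) unfolding pm.subspace_def by (simp add: add scale zero)
  with assms(1,2,4) have "u \<in> {u \<in> V. T u \<in> W}"
    by (intro pm.span_induct[of u S "\<lambda>u. u \<in> {u \<in> V. T u \<in> W}"]) (auto simp: Collect_mem_eq)
  then show ?thesis by simp
qed

lemma pow_closed: "u \<in> V \<Longrightarrow> (T ^^ n) u \<in> V"
  by (induction n) (auto intro: closed)

definition eval_poly :: "complex poly \<Rightarrow> ('b \<Rightarrow>\<^sub>0 complex) \<Rightarrow> ('b \<Rightarrow>\<^sub>0 complex)" where
  "eval_poly p u = (\<Sum>n\<le>degree p. pscale (coeff p n) ((T ^^ n) u))"

lemma eval_poly_altdef:
  "degree p \<le> N \<Longrightarrow> eval_poly p u = (\<Sum>n\<le>N. pscale (coeff p n) ((T ^^ n) u))"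
  unfolding eval_poly_def by (rule sum.mono_neutral_left) (auto simp: coeff_eq_0)

lemma eval_poly_closed: "u \<in> V \<Longrightarrow> eval_poly p u \<in> V"
  unfolding eval_poly_def by (intro pm.subspace_sum pm.subspace_scale subspace pow_closed)

lemma eval_poly_linear_factor:
  assumes "u \<in> V"
  shows "eval_poly ([:-r, 1:] * p) u = T (eval_poly p u) - pscale r (eval_poly p u)"
proof -
  let ?N = "degree p"
  have coeff: "coeff ([:-r, 1:] * p) (Suc n) = coeff p n - r * coeff p (Suc n)" for n
    by simp
  have "eval_poly ([:-r, 1:] * p) u
      = (\<Sum>n\<le>Suc ?N. pscale (coeff ([:-r, 1:] * p) n) ((T ^^ n) u))"
    using degree_mult_le[of "[:-r, 1:]" p] by (intro eval_poly_altdef) simp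
  also have "\<dots> = (\<Sum>n\<le>?N. pscale (coeff p n) ((T ^^ Suc n) u))
      - (pscale (r * coeff p 0) u + (\<Sum>n\<le>?N. pscale (r * coeff p (Suc n)) ((T ^^ Suc n) u)))"
    unfolding sum.atMost_Suc_shift coeff
    by (simp add: pm.scale_left_diff_distrib sum_subtractf)
  also have "(\<Sum>n\<le>?N. pscale (coeff p n) ((T ^^ Suc n) u)) = T (eval_poly p u)"
    unfolding eval_poly_def using assms
    by (simp add: sum scale pow_closed pm.subspace_scale[OF subspace])
  also have "pscale (r * coeff p 0) u + (\<Sum>n\<le>?N. pscale (r * coeff p (Suc n)) ((T ^^ Suc n) u))
      = (\<Sum>n\<le>Suc ?N. pscale (r * coeff p n) ((T ^^ n) u))"
    unfolding sum.atMost_Suc_shift by simp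
  also have "\<dots> = pscale r (eval_poly p u)"
    by (subst eval_poly_altdef[of p "Suc ?N"])
       (auto simp: pm.scale_sum_right pm.scale_right_distrib)
  finally show ?thesis .
qed

text \<open>If \<open>p\<close> is \<open>x - r\<close> times \<open>q\<close>, then either
  \<open>eval_poly q u\<close> is nonzero, hence an eigenvector for \<open>r\<close>, or
  \<open>q\<close> is an annihilating polynomial of smaller degree.\<close>

lemma eigenvector_if_annihilated:
  assumes "u \<in> V" "u \<noteq> 0" "p \<noteq> 0" "eval_poly p u = 0"
  shows "\<exists>x\<in>V. x \<noteq> 0 \<and> (\<exists>\<mu>. T x = pscale \<mu> x)"
  using assms(3,4)
proof (induction "degree p" arbitrary: p)
  case 0
  then obtain c where "p = [:c:]" by (metis degree_eq_zeroE)
  with 0 assms(2) show ?case by (simp add: eval_poly_def)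
next
  case (Suc n)
  obtain r where "poly p r = 0"
    using alg_closed_imp_poly_has_root[of p] Suc(2) by auto
  then obtain q where p: "p = [:-r, 1:] * q"
    by (metis poly_eq_0_iff_dvd dvdE)
  with Suc have q: "q \<noteq> 0" by auto
  then have "degree q = n"
    using Suc(2) by (simp add: p degree_mult_eq del: mult_pCons_left)
  show ?case
  proof (cases "eval_poly q u = 0")
    case True
    then show ?thesis using Suc(1)[of q] \<open>degree q = n\<close> q by simp
  next
    case False
    moreover have "T (eval_poly q u) = pscale r (eval_poly q u)"
      using Suc(4) eval_poly_linear_factor[OF assms(1)] by (simp add: p del: mult_pCons_left)
    ultimately show ?thesis using eval_poly_closed[OF assms(1)] by blast
  qed
qed

text \<open>The \<open>card B + 1\<close> vectors \<open>u, T u, ...\<close> satisfy a linear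
  relation, which is a nonzero polynomial annihilating \<open>u\<close>.\<close>

lemma eigenvector_exists:
  assumes "V \<subseteq> pm.span B" "finite B" "u \<in> V" "u \<noteq> 0"
  shows "\<exists>x\<in>V. x \<noteq> 0 \<and> (\<exists>\<mu>. T x = pscale \<mu> x)"
proof -
  let ?f = "\<lambda>n. (T ^^ n) u" and ?n = "card B"
  have "\<exists>p. p \<noteq> 0 \<and> eval_poly p u = 0"
  proof (cases "inj_on ?f {..?n}")
    case True
    have "pm.dependent (?f ` {..?n})"
    proof (rule ccontr)
      assume "\<not> pm.dependent (?f ` {..?n})"
      then have "card (?f ` {..?n}) \<le> card B"
        using assms pow_closed by (intro pm.independent_span_bound[THEN conjunct2]) auto
      then show False by (simp add: card_image[OF True])
    qed
    then obtain c where c: "(\<Sum>x\<in>?f ` {..?n}. pscale (c x) x) = 0" "\<exists>x\<in>?f ` {..?n}. c x \<noteq> 0"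
      by (auto simp: pm.dependent_finite)
    then obtain k where k: "k \<le> ?n" "c (?f k) \<noteq> 0" by auto
    define p where "p = (\<Sum>n\<le>?n. monom (c (?f n)) n)"
    have coeff: "coeff p n = (if n \<le> ?n then c (?f n) else 0)" for n
      by (simp add: p_def coeff_sum)
    have "degree p \<le> ?n" by (rule degree_le) (simp add: coeff)
    then have "eval_poly p u = (\<Sum>n\<le>?n. pscale (c (?f n)) (?f n))"
      by (simp add: eval_poly_altdef coeff)
    also have "\<dots> = 0" using c(1) by (simp add: sum.reindex[OF True])
    finally show ?thesis using k coeff[of k] by (intro exI[of _ p]) auto
  next
    case False
    \<comment> \<open>When two powers coincide, the set of vectors is smaller and may be
      independent, so the relation is written down directly.\<close>
    then obtain k l where kl: "k \<noteq> l" "?f k = ?f l" by (auto simp: inj_on_def)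
    define p where "p = monom 1 k - monom (1::complex) l"
    have "coeff p k = 1" using kl by (simp add: p_def)
    moreover have "degree p \<le> max k l"
      unfolding p_def by (intro degree_diff_le order.trans[OF degree_monom_le]) auto
    then have "eval_poly p u = (\<Sum>n\<le>max k l. (if n = k then ?f k else 0) - (if n = l then ?f l else 0))"
      using kl by (subst eval_poly_altdef) (auto simp: p_def intro!: sum.cong)
    then have "eval_poly p u = 0"
      using kl by (simp add: sum_subtractf)
    ultimately show ?thesis by (intro exI[of _ p]) auto
  qed
  then show ?thesis using eigenvector_if_annihilated[OF assms(3,4)] by blast
qed

lemma eigenvectors_independent:
  assumes "finite S" "\<And>k. k \<in> S \<Longrightarrow> x k \<in> V" "\<And>k. k \<in> S \<Longrightarrow> x k \<noteq> 0"
    and "\<And>k. k \<in> S \<Longrightarrow> T (x k) = pscale (\<mu> k) (x k)" "inj_on \<mu> S"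
    and "(\<Sum>k\<in>S. pscale (c k) (x k)) = 0"
  shows "\<forall>k\<in>S. c k = 0"
  using assms
proof (induction S arbitrary: c)
  case (insert j S)
  have V: "pscale (d k) (x k) \<in> V" if "k \<in> insert j S" for d k
    using insert.prems(1) that by (intro pm.subspace_scale[OF subspace]) auto
  \<comment> \<open>\<open>T\<close> minus the eigenvalue of \<open>x j\<close> removes that term
    and multiplies each other one by a nonzero \<open>\<mu> k - \<mu> j\<close>.\<close>
  have "0 = T (\<Sum>k\<in>insert j S. pscale (c k) (x k)) - pscale (\<mu> j) (\<Sum>k\<in>insert j S. pscale (c k) (x k))"
    using insert.prems(5) by (simp add: zero)
  also have "\<dots> = (\<Sum>k\<in>insert j S. pscale (c k * (\<mu> k - \<mu> j)) (x k))"
    using insert.prems(1,3)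
    by (subst sum) (auto simp: V scale pm.scale_sum_right sum_subtractf[symmetric]
        algebra_simps pm.scale_left_diff_distrib intro!: sum.cong simp del: sum.insert)
  also have "\<dots> = (\<Sum>k\<in>S. pscale (c k * (\<mu> k - \<mu> j)) (x k))"
    using insert.hyps by simp
  finally have "\<forall>k\<in>S. c k * (\<mu> k - \<mu> j) = 0"
    using insert.prems by (intro insert.IH) auto
  then have "\<forall>k\<in>S. c k = 0"
    using inj_onD[OF insert.prems(4), of _ j] insert.hyps by auto
  moreover from this have "pscale (c j) (x j) = 0"
    using insert.prems(5) insert.hyps by simp
  ultimately show ?case using insert.prems(2) by simp
qed simp

lemma eigenvectors_inj_independent:
  assumes "finite S" "\<And>k. k \<in> S \<Longrightarrow> x k \<in> V" "\<And>k. k \<in> S \<Longrightarrow> x k \<noteq> 0"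
    and "\<And>k. k \<in> S \<Longrightarrow> T (x k) = pscale (\<mu> k) (x k)" "inj_on \<mu> S"
  shows "inj_on x S" "pm.independent (x ` S)"
proof -
  show inj: "inj_on x S"
  proof (rule inj_onI)
    fix k l assume kl: "k \<in> S" "l \<in> S" "x k = x l"
    then have "pscale (\<mu> k) (x k) = pscale (\<mu> l) (x k)" using assms(4) by metis
    then have "\<mu> k = \<mu> l" using assms(3)[OF kl(1)] by simp
    then show "k = l" using kl assms(5) by (simp add: inj_on_def)
  qed
  show "pm.independent (x ` S)"
  proof (rule pm.independent_if_scalars_zero)
    fix d y assume "(\<Sum>y\<in>x ` S. pscale (d y) y) = 0" "y \<in> x ` S"
    then show "d y = 0"
      using eigenvectors_independent[OF assms, of "\<lambda>k. d (x k)"] by (auto simp: sum.reindex[OF inj])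
  qed (use assms in auto)
qed

end

lemma lie_module_restrict:
  assumes "lie_module \<gg> \<rho> V" "\<hh> \<subseteq> \<gg>" "U \<subseteq> V" "pm.subspace U" "\<And>a. a \<in> \<hh> \<Longrightarrow> \<rho> a ` U \<subseteq> U"
  shows "lie_module \<hh> \<rho> U"
proof -
  have "linear_map_on U (\<rho> a)" if "a \<in> \<hh>" for a
    using assms(1-3) that unfolding lie_module_def linear_map_on_def by (meson subsetD)
  then show ?thesis
    using assms unfolding lie_module_def by (meson subsetD)
qed

text \<open>Forces a chain of weight vectors to end when the dimension is finite.\<close>

lemma card_eigenvectors_le:
  assumes "linear_operator_on V T" "V \<subseteq> pm.span B" "finite B" "finite S"
    and "\<And>k. k \<in> S \<Longrightarrow> x k \<in> V" "\<And>k. k \<in> S \<Longrightarrow> x k \<noteq> 0"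
    and "\<And>k. k \<in> S \<Longrightarrow> T (x k) = pscale (\<mu> k) (x k)" "inj_on \<mu> S"
  shows "card S \<le> card B"
proof -
  note ind = linear_operator_on.eigenvectors_inj_independent[OF assms(1,4-8)]
  have "card (x ` S) \<le> card B"
    using assms(2,3,5) ind(2) by (intro pm.independent_span_bound[THEN conjunct2]) auto
  then show ?thesis by (simp add: card_image[OF ind(1)])
qed

text \<open>Highest weight theory: raise an eigenvector of \<open>A0star\<close> until the chain
  breaks off, then lower from the top. The lowered chain spans a submodule, hence \<open>V\<close>,
  and its length determines the highest weight.\<close>

lemma irreducible_sl2_standard_basis:
  assumes irr: "irreducible_module sl \<rho> V" and dim: "pm.dim V = M + 1"
  shows "\<exists>v. standard_basis \<rho> V M v"
proof -
  have mod: "lie_module sl \<rho> V" and nonzero: "V \<noteq> {0}"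
    and simple: "\<And>U. U \<subseteq> V \<Longrightarrow> lie_module sl \<rho> U \<Longrightarrow> U \<noteq> {0} \<Longrightarrow> U = V"
    using irr by (auto simp: irreducible_module_def)
  have op: "linear_operator_on V (\<rho> a)" if "a \<in> sl" for a
    using mod that by unfold_locales (auto simp: lie_module_def)
  interpret h: linear_operator_on V "\<rho> A0star" by (rule op) (rule sl2_in_sl)
  interpret e: linear_operator_on V "\<rho> raise" by (rule op) (rule sl2_in_sl)
  interpret f: linear_operator_on V "\<rho> lower" by (rule op) (rule sl2_in_sl)
  have add: "\<rho> (a + b) v = \<rho> a v + \<rho> b v"
    and scale: "\<rho> (mscale c a) v = pscale c (\<rho> a v)"
    and br: "\<rho> (bracket a b) v = \<rho> a (\<rho> b v) - \<rho> b (\<rho> a v)"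
    if "v \<in> V" "a \<in> sl" "b \<in> sl" for a b c v
    using mod that unfolding lie_module_def by blast+
  have expand: "\<rho> a v = pscale (a$1$1) (\<rho> A0star v) + (pscale (a$1$2) (\<rho> raise v) + pscale (a$2$1) (\<rho> lower v))"
    if "a \<in> sl" "v \<in> V" for a v
    using that(2) by (subst sl2_expand[OF that(1)])
      (simp add: add scale[OF that(2) _ sl_zero] sl2_in_sl sl_add sl_mscale)
  have he: "\<rho> A0star (\<rho> raise v) = \<rho> raise (\<rho> A0star v) + pscale 2 (\<rho> raise v)"
    and hf: "\<rho> A0star (\<rho> lower v) = \<rho> lower (\<rho> A0star v) + pscale (-2) (\<rho> lower v)"
    and ef: "\<rho> raise (\<rho> lower v) = \<rho> lower (\<rho> raise v) + \<rho> A0star v" if "v \<in> V" for v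
    using br[OF that sl2_in_sl(1,2)] br[OF that sl2_in_sl(1,3)] br[OF that sl2_in_sl(2,3)]
    by (simp_all add: sl2_brackets scale[OF that sl2_in_sl(2) sl2_in_sl(2)]
        scale[OF that sl2_in_sl(3) sl2_in_sl(3)] algebra_simps del: pm.scale_minus_left)

  obtain B where B: "B \<subseteq> V" "pm.independent B" "V \<subseteq> pm.span B" "card B = M + 1"
    using pm.basis_exists[of V] dim by metis
  \<comment> \<open>An infinite \<open>B\<close> would have \<open>card B = 0\<close>, not
    \<open>M + 1\<close>.\<close>
  then have fin: "finite B" by (metis add_is_0 card.infinite one_neq_zero)
  obtain u where "u \<in> V" "u \<noteq> 0"
    using nonzero pm.subspace_0[OF h.subspace] by auto
  with h.eigenvector_exists B(3) fin obtain x \<mu>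
    where x: "x \<in> V" "x \<noteq> 0" "\<rho> A0star x = pscale \<mu> x" by blast
  have hex: "\<rho> A0star ((\<rho> raise ^^ k) x) = pscale (\<mu> + 2 * of_nat k) ((\<rho> raise ^^ k) x)" for k
  proof (induction k)
    case (Suc k)
    have "\<rho> A0star (\<rho> raise ((\<rho> raise ^^ k) x))
        = pscale (\<mu> + 2 * of_nat k + 2) (\<rho> raise ((\<rho> raise ^^ k) x))"
      by (simp only: he[OF e.pow_closed[OF x(1)]] Suc e.scale[OF e.pow_closed[OF x(1)]]
        pm.scale_left_distrib[of "\<mu> + 2 * of_nat k" 2])
    then show ?case by (simp add: algebra_simps)
  qed (simp add: x)
  \<comment> \<open>The weights \<open>\<mu> + 2 * k\<close> are distinct, so \<open>M + 2\<close>
    nonzero members of the chain would be too many independent vectors.\<close>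
  have "\<exists>k. (\<rho> raise ^^ k) x = 0"
  proof (rule ccontr)
    assume "\<not> ?thesis"
    then have "card {..M + 1} \<le> card B"
      by (intro card_eigenvectors_le[OF h.linear_operator_on_axioms B(3) fin,
            where x = "\<lambda>k. (\<rho> raise ^^ k) x" and \<mu> = "\<lambda>k. \<mu> + 2 * of_nat k"])
         (auto simp: hex inj_on_def intro: e.pow_closed x)
    then show False by (simp add: B(4))
  qed
  then obtain k0 where k0: "(\<rho> raise ^^ Suc k0) x = 0" "(\<rho> raise ^^ k0) x \<noteq> 0"
    using x(2) exists_least_lemma[of "\<lambda>k. (\<rho> raise ^^ k) x = 0"] by auto
  define y where "y = (\<rho> raise ^^ k0) x"
  define \<kappa> where "\<kappa> = \<mu> + 2 * of_nat k0"
  have y: "y \<in> V" "y \<noteq> 0" "\<rho> raise y = 0" "\<rho> A0star y = pscale \<kappa> y"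
    using k0 hex[of k0] e.pow_closed[OF x(1)] by (simp_all add: y_def \<kappa>_def)

  define z where "z k = (\<rho> lower ^^ k) y" for k
  have z: "z k \<in> V" "\<rho> lower (z k) = z (Suc k)" for k
    using f.pow_closed[OF y(1)] by (simp_all add: z_def)
  have hz: "\<rho> A0star (z k) = pscale (\<kappa> - 2 * of_nat k) (z k)" for k
  proof (induction k)
    case (Suc k)
    have "\<rho> A0star (z (Suc k)) = pscale (\<kappa> - 2 * of_nat k + - 2) (z (Suc k))"
      unfolding z(2)[symmetric] hf[OF z(1)] Suc f.scale[OF z(1)] pm.scale_left_distrib ..
    then show ?case by (simp add: algebra_simps)
  qed (simp add: z_def y)
  \<comment> \<open>The coefficient is the sum of the weights \<open>\<kappa> - 2 * j\<close> over
    \<open>j \<le> k\<close>: moving \<open>raise\<close> past each \<open>lower\<close> leaves one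
    \<open>A0star\<close>.\<close>
  have ez: "\<rho> raise (z (Suc k)) = pscale (of_nat (Suc k) * (\<kappa> - of_nat k)) (z k)" for k
  proof (induction k)
    case 0
    show ?case using y ef[OF y(1)] by (simp add: z_def f.zero)
  next
    case (Suc k)
    have "\<rho> raise (z (Suc (Suc k))) = \<rho> lower (\<rho> raise (z (Suc k))) + \<rho> A0star (z (Suc k))"
      unfolding z(2)[of "Suc k", symmetric] by (rule ef[OF z(1)])
    also have "\<dots> = pscale (of_nat (Suc k) * (\<kappa> - of_nat k) + (\<kappa> - 2 * of_nat (Suc k))) (z (Suc k))"
      by (simp only: Suc f.scale[OF z(1)] z(2) hz pm.scale_left_distrib)
    also have "of_nat (Suc k) * (\<kappa> - of_nat k) + (\<kappa> - 2 * of_nat (Suc k))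
        = of_nat (Suc (Suc k)) * (\<kappa> - of_nat (Suc k))"
      by (simp add: algebra_simps)
    finally show ?case .
  qed
  have "\<exists>k. z k = 0"
  proof (rule ccontr)
    assume "\<not> ?thesis"
    then have "card {..M + 1} \<le> card B"
      by (intro card_eigenvectors_le[OF h.linear_operator_on_axioms B(3) fin,
            where x = z and \<mu> = "\<lambda>k. \<kappa> - 2 * of_nat k"])
         (auto simp: hz inj_on_def intro: z)
    then show False by (simp add: B(4))
  qed
  define n where "n = (LEAST k. z k = 0)"
  have zn: "z n = 0" unfolding n_def using \<open>\<exists>k. z k = 0\<close> by (rule LeastI_ex)
  have z_nonzero: "z k \<noteq> 0" if "k < n" for k
    using that not_less_Least unfolding n_def by blast
  have "z 0 \<noteq> 0" using y by (simp add: z_def)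
  with zn have "n > 0" by (metis gr0I)

  \<comment> \<open>Because \<open>z n = 0\<close>, this span is also closed under
    \<open>lower\<close>; irreducibility then makes \<open>n\<close> the dimension.\<close>
  define U where "U = pm.span (z ` {..<n})"
  have U: "pm.subspace U" by (simp add: U_def)
  have zU: "z k \<in> U" if "k \<le> n" for k
    using that zn pm.span_zero by (auto simp: U_def le_less intro: pm.span_base)
  have "U \<subseteq> V"
    unfolding U_def by (rule pm.span_minimal) (auto simp: z h.subspace)
  have gens: "\<rho> raise (z k) \<in> U" "\<rho> A0star (z k) \<in> U" "\<rho> lower (z k) \<in> U" if "k < n" for k
  proof -
    have "\<rho> raise (z 0) = 0" using y by (simp add: z_def)
    then show "\<rho> raise (z k) \<in> U"
      using that ez[of "k - 1"]
      by (cases k) (auto intro!: pm.subspace_scale[OF U] zU simp: pm.subspace_0[OF U])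
  qed (use that in \<open>auto simp: z hz intro!: pm.subspace_scale[OF U] zU\<close>)
  have "\<rho> a w \<in> U" if "a \<in> sl" "w \<in> U" for a w
  proof -
    have "w \<in> pm.span (z ` {..<n})" "w \<in> V" using that \<open>U \<subseteq> V\<close> by (auto simp: U_def)
    moreover have "z ` {..<n} \<subseteq> V" using z by auto
    ultimately have "\<rho> A0star w \<in> U" "\<rho> raise w \<in> U" "\<rho> lower w \<in> U"
      using gens U by (auto intro!: h.span_image[of "z ` {..<n}" U w] e.span_image[of "z ` {..<n}" U w] f.span_image[of "z ` {..<n}" U w])
    then show ?thesis
      using that(1) \<open>w \<in> V\<close> by (auto simp: expand intro!: pm.subspace_add[OF U] pm.subspace_scale[OF U])
  qed
  then have "lie_module sl \<rho> U"
    using \<open>U \<subseteq> V\<close> U by (intro lie_module_restrict[OF mod]) auto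
  moreover have "U \<noteq> {0}"
    using zU[of 0] \<open>z 0 \<noteq> 0\<close> by auto
  ultimately have UV: "U = V" using simple \<open>U \<subseteq> V\<close> by blast

  have "inj_on z {..<n}" "pm.independent (z ` {..<n})"
    by (rule h.eigenvectors_inj_independent[where \<mu> = "\<lambda>k. \<kappa> - 2 * of_nat k"];
        auto simp: hz inj_on_def intro: z dest: z_nonzero)+
  then have "pm.dim V = n"
    unfolding UV[symmetric] U_def
    using pm.dim_span_eq_card_independent[of "z ` {..<n}"] card_image[of z "{..<n}"] by simp
  with dim have n: "n = Suc M" by simp
  \<comment> \<open>At the end of the chain, \<open>ez\<close> says that
    \<open>(M + 1) * (\<kappa> - M)\<close> times the nonzero vector \<open>z M\<close> is
    zero.\<close>
  have highest: "\<kappa> = of_nat M"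
    using ez[of M] zn z_nonzero[of M] of_nat_neq_0[of M, where 'a = complex]
    by (simp add: n e.zero del: of_nat_Suc)

  \<comment> \<open>For binary forms, \<open>k\<close> applications of \<open>lower\<close> to the
    top monomial give \<open>M! / (M - k)!\<close> times \<open>mon (M - k) k\<close>; this factor
    is divided out.\<close>
  define v where "v k = pscale (fact (M - k) / fact M) (z k)" for k
  have v_V: "v k \<in> V" for k unfolding v_def by (intro pm.subspace_scale h.subspace z)
  have hv: "\<rho> A0star (v k) = pscale (of_nat M - 2 * of_nat k) (v k)" for k
    by (simp add: v_def h.scale z hz highest mult.commute)
  have ev: "\<rho> raise (v k) = pscale (of_nat k) (v (k - 1))" if "k \<le> M" for k
  proof (cases k)
    case 0
    then show ?thesis using y by (simp add: v_def e.scale z_def)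
  next
    case (Suc l)
    have "M - l = Suc (M - Suc l)" using that Suc by simp
    then have "fact (M - l) = (of_nat M - of_nat l) * (fact (M - Suc l) :: complex)"
      using that Suc by (simp add: of_nat_diff)
    then show ?thesis
      by (simp add: v_def e.scale z Suc ez highest mult_ac del: of_nat_Suc)
  qed
  have fv: "\<rho> lower (v k) = pscale (of_nat (M - k)) (v (Suc k))" if "k \<le> M" for k
  proof (cases "k = M")
    case True
    then show ?thesis using zn by (simp add: v_def f.scale z n)
  next
    case False
    then have "M - k = Suc (M - Suc k)" using that by simp
    then show ?thesis by (simp add: v_def f.scale z)
  qed
  have v_nonzero: "v k \<noteq> 0" if "k \<le> M" for k
    using that z_nonzero[of k] by (simp add: v_def n)
  have "inj_on v {..M}" "pm.independent (v ` {..M})"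
    by (rule h.eigenvectors_inj_independent[where \<mu> = "\<lambda>k. of_nat M - 2 * of_nat k"];
        auto simp: hv inj_on_def intro: v_V dest: v_nonzero)+
  moreover have "pm.span (v ` {..M}) = V"
  proof
    show "pm.span (v ` {..M}) \<subseteq> V" by (rule pm.span_minimal) (auto simp: v_V h.subspace)
    have "z k \<in> pm.span (v ` {..M})" if "k < n" for k
    proof -
      have "z k = pscale (fact M / fact (M - k)) (v k)" by (simp add: v_def)
      then show ?thesis
        using that by (auto simp: n intro!: pm.span_scale intro: pm.span_base)
    qed
    then show "V \<subseteq> pm.span (v ` {..M})"
      unfolding UV[symmetric] U_def by (intro pm.span_minimal) auto
  qed
  ultimately show ?thesis
    unfolding standard_basis_def
    by (intro exI[of _ v]) (simp add: expand v_V hv ev fv add.assoc)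
qed

section \<open>A weight basis of the harmonic polynomials\<close>

lemma independent_family_zero:
  assumes "pm.independent (x ` I)" "inj_on x I" "finite I" "(\<Sum>i\<in>I. pscale (c i) (x i)) = 0" "i \<in> I"
  shows "c i = 0"
proof -
  have "(\<Sum>y\<in>x ` I. pscale (c (inv_into I x y)) y) = 0"
    using assms(4) by (simp add: sum.reindex[OF assms(2)] inv_into_f_f[OF assms(2)])
  then have "c (inv_into I x (x i)) = 0"
    using assms(1,3,5) by (intro pm.independentD[of "x ` I" "x ` I"]) auto
  then show ?thesis by (simp add: inv_into_f_f[OF assms(2,5)])
qed

text \<open>Equal members at two indices satisfy the relation with coefficients 1 and -1, so the
  condition on families also yields injectivity, which independence of the image set does not
  express.\<close>

lemma independent_familyI:
  assumes "finite I" "\<And>c i. (\<Sum>i\<in>I. pscale (c i) (x i)) = 0 \<Longrightarrow> i \<in> I \<Longrightarrow> c i = 0"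
  shows "inj_on x I" "pm.independent (x ` I)"
proof -
  show inj: "inj_on x I"
  proof (rule inj_onI, rule ccontr)
    fix i j assume ij: "i \<in> I" "j \<in> I" "x i = x j" "i \<noteq> j"
    define c where "c k = (if k = i then 1 else if k = j then -1 else 0 :: complex)" for k
    have "(\<Sum>k\<in>I. pscale (c k) (x k)) = (\<Sum>k\<in>I. (if k = i then x i else 0) - (if k = j then x j else 0))"
      using ij(4) by (intro sum.cong) (auto simp: c_def)
    also have "\<dots> = 0" using ij assms(1) by (simp add: sum_subtractf)
    finally have "c i = 0" using assms(2) ij(1) by blast
    then show False by (simp add: c_def)
  qed
  show "pm.independent (x ` I)"
  proof (rule pm.independent_if_scalars_zero)
    fix d y assume "(\<Sum>y\<in>x ` I. pscale (d y) y) = 0" "y \<in> x ` I"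
    then show "d y = 0"
      using assms(2)[of "\<lambda>k. d (x k)"] by (auto simp: sum.reindex[OF inj])
  qed (use assms in auto)
qed

text \<open>An inverse binomial coefficient up to the factor \<open>M!\<close>. Raising takes the
  plain delta function at \<open>a\<close> to \<open>M - a + 1\<close> times the one at
  \<open>a - 1\<close>; the ratio of consecutive weights turns this factor into
  \<open>a\<close>.\<close>

definition weight_const :: "nat \<Rightarrow> nat \<Rightarrow> complex" where
  "weight_const M a = fact a * fact (M - a)"

lemma weight_const_nonzero [simp]: "weight_const M a \<noteq> 0"
  by (simp add: weight_const_def)

lemma weight_const_Suc:
  assumes "a < M"
  shows "of_nat (M - a) * weight_const M (Suc a) = of_nat (Suc a) * weight_const M a"
proof -
  have "M - a = Suc (M - Suc a)" using assms by simp
  then show ?thesis by (simp add: weight_const_def)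
qed

definition delta :: "nat \<Rightarrow> nat \<Rightarrow> nat \<Rightarrow> complex" where
  "delta M a c = (if c = a then weight_const M a else 0)"

text \<open>The action of \<open>\<ss>\<ll>\<^sub>2\<close> on functions of the weight index, evaluated at a delta function.\<close>

lemma delta_action:
  assumes "a \<le> M" "c \<le> M"
  shows "x * (of_nat M - 2 * of_nat c) * delta M a c + y * of_nat (M - c) * delta M a (Suc c)
      + z * of_nat c * delta M a (c - 1)
    = x * (of_nat M - 2 * of_nat a) * delta M a c + y * of_nat a * delta M (a - 1) c
      + z * of_nat (M - a) * delta M (Suc a) c"
proof -
  have 1: "of_nat (M - c) * delta M a (Suc c) = of_nat a * delta M (a - 1) c"
    using assms weight_const_Suc[of c M] by (cases a) (auto simp: delta_def)
  have 2: "of_nat c * delta M a (c - 1) = of_nat (M - a) * delta M (Suc a) c"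
    using assms weight_const_Suc[of a M] by (cases c) (auto simp: delta_def)
  show ?thesis
    using 1 2 by (simp add: mult.assoc) (simp add: delta_def)
qed

context quadric
begin

section \<open>Harmonic polynomials as functions of two weights\<close>

definition col :: "'n \<Rightarrow> 2" where "col x = (if x = p \<or> x = s then 1 else 2)"
definition row :: "'n \<Rightarrow> 2" where "row x = (if x = p \<or> x = r then 1 else 2)"

text \<open>With the variables indexed by pairs (column, row), this is the Kronecker sum \<alpha>
  \<otimes> 1 + 1 \<otimes> \<beta>.\<close>

definition embed :: "(complex^2^2) \<times> (complex^2^2) \<Rightarrow> complex^'n^'n" where
  "embed ab = (\<chi> x y. (if row x = row y then fst ab $ col x $ col y else 0)
     + (if col x = col y then snd ab $ row x $ row y else 0))"

text \<open>The degree in the second column, and next to it in the second row. On monomials of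
  degree \<open>M\<close> the diagonal generator of the respective summand acts by \<open>M\<close>
  minus twice this number.\<close>

definition col_weight :: "('n \<Rightarrow>\<^sub>0 nat) \<Rightarrow> nat" where "col_weight m = lookup m r + lookup m q"
definition row_weight :: "('n \<Rightarrow>\<^sub>0 nat) \<Rightarrow> nat" where "row_weight m = lookup m s + lookup m q"

definition form :: "nat \<Rightarrow> (nat \<Rightarrow> nat \<Rightarrow> complex) \<Rightarrow> 'n polynomial" where
  "form M g = Abs_poly_mapping
     (\<lambda>m. if mdeg m = M then g (col_weight m) (row_weight m) / of_nat (norm2 m) else 0)"

lemma ncoeff_form:
  "ncoeff (form M g) m = (if mdeg m = M then g (col_weight m) (row_weight m) else 0)"
proof -
  have "finite {m. (if mdeg m = M then g (col_weight m) (row_weight m) / of_nat (norm2 m) else 0) \<noteq> 0}"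
    by (rule finite_subset[OF _ finite_mdeg[of M]]) auto
  then show ?thesis
    by (simp add: ncoeff_def form_def Abs_poly_mapping_inverse)
qed

text \<open>The pair \<open>p, q\<close> and the pair \<open>r, s\<close> both raise each weight by
  one, so the two terms of the Laplacian agree.\<close>

lemma form_harmonic: "form M g \<in> harmonic M"
proof -
  have "laplace (form M g) = 0"
    by (rule poly_eqI_ncoeff)
       (simp add: laplace_def ncoeff_D ncoeff_form mdeg_add col_weight_def row_weight_def
         lookup_add lookup_single)
  then show ?thesis by (simp add: harmonic_def ncoeff_homog ncoeff_form)
qed

text \<open>The member of its weight class in which \<open>r\<close> or \<open>s\<close> is missing:
  all pairs \<open>r, s\<close> have been traded for pairs \<open>p, q\<close>.\<close>

definition exponent :: "nat \<Rightarrow> nat \<Rightarrow> nat \<Rightarrow> ('n \<Rightarrow>\<^sub>0 nat)" where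
  "exponent M a b = Poly_Mapping.single p (M - max a b) + Poly_Mapping.single q (min a b)
     + Poly_Mapping.single r (a - min a b) + Poly_Mapping.single s (b - min a b)"

lemma exponent:
  assumes "a \<le> M" "b \<le> M"
  shows "mdeg (exponent M a b) = M" "col_weight (exponent M a b) = a" "row_weight (exponent M a b) = b"
  using assms by (auto simp: exponent_def mdeg_add col_weight_def row_weight_def lookup_add lookup_single)

lemma harmonic_ncoeff_shift:
  assumes "f \<in> harmonic M"
  shows "ncoeff f (m + Poly_Mapping.single p d + Poly_Mapping.single q d)
    = ncoeff f (m + Poly_Mapping.single r d + Poly_Mapping.single s d)"
proof (induction d arbitrary: m)
  case (Suc d)
  have step: "ncoeff f (m + Poly_Mapping.single p 1 + Poly_Mapping.single q 1)
      = ncoeff f (m + Poly_Mapping.single r 1 + Poly_Mapping.single s 1)" for m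
  proof -
    have "ncoeff (laplace f) m = 0" by (simp add: harmonic_laplace[OF assms])
    then show ?thesis unfolding laplace_def ncoeff_diff ncoeff_D by simp
  qed
  have split: "Poly_Mapping.single x (Suc d) = Poly_Mapping.single x 1 + Poly_Mapping.single x d" for x :: 'n
    by (simp add: single_add[symmetric])
  have "ncoeff f (m + Poly_Mapping.single p (Suc d) + Poly_Mapping.single q (Suc d))
      = ncoeff f ((m + Poly_Mapping.single p 1 + Poly_Mapping.single q 1)
          + Poly_Mapping.single p d + Poly_Mapping.single q d)"
    by (simp only: split add_ac)
  also have "\<dots> = ncoeff f ((m + Poly_Mapping.single r d + Poly_Mapping.single s d)
          + Poly_Mapping.single p 1 + Poly_Mapping.single q 1)"
    unfolding Suc by (simp only: add_ac)
  also have "\<dots> = ncoeff f (m + Poly_Mapping.single r (Suc d) + Poly_Mapping.single s (Suc d))"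
    unfolding step by (simp only: split add_ac)
  finally show ?case .
qed simp

lemma harmonic_ncoeff:
  assumes "f \<in> harmonic M" "mdeg m = M"
  shows "ncoeff f m = ncoeff f (exponent M (col_weight m) (row_weight m))"
proof -
  define d where "d = min (lookup m r) (lookup m s)"
  define n where "n = Poly_Mapping.single p (lookup m p) + Poly_Mapping.single q (lookup m q)
    + Poly_Mapping.single r (lookup m r - d) + Poly_Mapping.single s (lookup m s - d)"
  have 1: "m = n + Poly_Mapping.single r d + Poly_Mapping.single s d"
    by (rule exponent_eqI) (simp_all add: n_def d_def lookup_add lookup_single)
  have 2: "exponent M (col_weight m) (row_weight m) = n + Poly_Mapping.single p d + Poly_Mapping.single q d"
    using assms(2)
    by (intro exponent_eqI)
       (auto simp: n_def d_def lookup_add lookup_single exponent_def col_weight_def row_weight_def mdeg_eq)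
  show ?thesis
    unfolding 2 harmonic_ncoeff_shift[OF assms(1)] 1[symmetric] ..
qed

lemma harmonic_eq_form:
  assumes "f \<in> harmonic M"
  shows "f = form M (\<lambda>a b. ncoeff f (exponent M a b))"
  using harmonic_ncoeff[OF assms] harmonic_homog[OF assms]
  by (intro poly_eqI_ncoeff) (auto simp: ncoeff_form ncoeff_homog)

text \<open>The factor \<open>lookup m x\<close> on both sides guards the truncated subtractions:
  where they would give a wrong index, it is zero.\<close>

lemma ncoeff_form_shift:
  "of_nat (lookup m x) * ncoeff (form M g) (m - Poly_Mapping.single x 1 + Poly_Mapping.single y 1)
   = of_nat (lookup m x) * (if mdeg m = M then
       g (col_weight m - (if col x = 2 then 1 else 0) + (if col y = 2 then 1 else 0))
         (row_weight m - (if row x = 2 then 1 else 0) + (if row y = 2 then 1 else 0)) else 0)"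
proof (cases "lookup m x = 0")
  case False
  define n where "n = m - Poly_Mapping.single x 1"
  have m: "m = n + Poly_Mapping.single x 1"
    unfolding n_def by (rule minus_single_add[OF False, symmetric])
  have xy: "x \<in> {p, q, r, s}" "y \<in> {p, q, r, s}" using univ by auto
  have wt: "col_weight (n + Poly_Mapping.single z 1) = col_weight n + (if col z = 2 then 1 else 0)"
    "row_weight (n + Poly_Mapping.single z 1) = row_weight n + (if row z = 2 then 1 else 0)"
    if "z \<in> {p, q, r, s}" for z
    using that by (auto simp: col_weight_def row_weight_def lookup_add lookup_single col_def row_def)
  show ?thesis
    unfolding n_def[symmetric] ncoeff_form wt[OF xy(2)] mdeg_add mdeg_single
    by (subst (3 4 5) m) (simp add: wt[OF xy(1), simplified] mdeg_add)
qed simp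

text \<open>Of the sixteen entries, the four between opposite corners of the matrix vanish, since
  they change both row and column.\<close>

lemma embed_sum:
  "(\<Sum>y\<in>UNIV. \<Sum>x\<in>UNIV. embed (\<alpha>, \<beta>) $ x $ y * F x y)
   = (\<alpha>$1$1 + \<beta>$1$1) * F p p + (\<alpha>$2$2 + \<beta>$2$2) * F q q + (\<alpha>$2$2 + \<beta>$1$1) * F r r + (\<alpha>$1$1 + \<beta>$2$2) * F s s
   + \<alpha>$1$2 * (F p r + F s q) + \<alpha>$2$1 * (F r p + F q s) + \<beta>$1$2 * (F p s + F r q) + \<beta>$2$1 * (F s p + F q r)"
  by (simp add: sum_univ embed_def col_def row_def algebra_simps)

text \<open>Each off-diagonal entry of \<alpha> or \<beta> occurs for two variables of one column or
  row. Their exponents add up to \<open>M - a\<close>, \<open>a\<close>, \<open>M - b\<close> or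
  \<open>b\<close>, so the result depends on the weights only.\<close>

lemma act_form:
  assumes "\<alpha> \<in> sl" "\<beta> \<in> sl"
  shows "act (embed (\<alpha>, \<beta>)) (form M g) = form M (\<lambda>a b.
      (\<alpha>$1$1 * (of_nat M - 2 * of_nat a) * g a b + \<alpha>$1$2 * of_nat (M - a) * g (Suc a) b
        + \<alpha>$2$1 * of_nat a * g (a - 1) b)
    + (\<beta>$1$1 * (of_nat M - 2 * of_nat b) * g a b + \<beta>$1$2 * of_nat (M - b) * g a (Suc b)
        + \<beta>$2$1 * of_nat b * g a (b - 1)))"
    (is "_ = ?r")
proof (rule poly_eqI_ncoeff)
  fix m
  define F where "F x y = of_nat (lookup m x) *
    ncoeff (form M g) (m - Poly_Mapping.single x 1 + Poly_Mapping.single y 1)" for x y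
  have "ncoeff (act (embed (\<alpha>, \<beta>)) (form M g)) m
      = (\<Sum>y\<in>UNIV. \<Sum>x\<in>UNIV. embed (\<alpha>, \<beta>) $ x $ y * F x y)"
    by (simp add: ncoeff_act F_def mult.assoc)
  also have "\<dots> = ncoeff ?r m"
  proof (cases "mdeg m = M")
    case False
    then show ?thesis unfolding embed_sum F_def ncoeff_form_shift by (simp add: ncoeff_form)
  next
    case True
    define a b where "a = col_weight m" and "b = row_weight m"
    define P Q R S where "P = lookup m p" and "Q = lookup m q" and "R = lookup m r" and "S = lookup m s"
    have wt: "a = R + Q" "b = S + Q" "M = P + Q + R + S"
      using True by (simp_all add: a_def b_def P_def Q_def R_def S_def col_weight_def row_weight_def mdeg_eq)
    have F: "F x y = of_nat (lookup m x) *
       g (a - (if col x = 2 then 1 else 0) + (if col y = 2 then 1 else 0))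
         (b - (if row x = 2 then 1 else 0) + (if row y = 2 then 1 else 0))" for x y
      unfolding F_def ncoeff_form_shift a_def b_def if_P[OF True] ..
    \<comment> \<open>The case distinctions here and below concern zero exponents, where the
      truncated weights may be off but the factor in front vanishes.\<close>
    have diag: "F p p = of_nat P * g a b" "F q q = of_nat Q * g a b"
      "F r r = of_nat R * g a b" "F s s = of_nat S * g a b"
      unfolding F P_def[symmetric] Q_def[symmetric] R_def[symmetric] S_def[symmetric]
      by (auto simp: col_def row_def wt; cases "Q = 0"; cases "R = 0"; cases "S = 0"; simp)+
    have cols: "F p r = of_nat P * g (Suc a) b" "F s q = of_nat S * g (Suc a) b"
      "F r p = of_nat R * g (a - 1) b" "F q s = of_nat Q * g (a - 1) b"
      unfolding F P_def[symmetric] Q_def[symmetric] R_def[symmetric] S_def[symmetric]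
      by (auto simp: col_def row_def wt; cases "Q = 0"; cases "R = 0"; cases "S = 0"; simp)+
    have rows: "F p s = of_nat P * g a (Suc b)" "F r q = of_nat R * g a (Suc b)"
      "F s p = of_nat S * g a (b - 1)" "F q r = of_nat Q * g a (b - 1)"
      unfolding F P_def[symmetric] Q_def[symmetric] R_def[symmetric] S_def[symmetric]
      by (auto simp: col_def row_def wt; cases "Q = 0"; cases "R = 0"; cases "S = 0"; simp)+
    have nums: "M - a = P + S" "M - b = P + R"
      by (simp_all add: wt)
    have ab: "of_nat a = (of_nat R + of_nat Q :: complex)" "of_nat b = (of_nat S + of_nat Q :: complex)"
      "of_nat M = (of_nat P + of_nat Q + of_nat R + of_nat S :: complex)"
      by (simp_all add: wt)
    show ?thesis
      unfolding embed_sum diag cols rows ncoeff_form if_P[OF True] a_def[symmetric] b_def[symmetric]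
        nums ab sl2_22[OF assms(1)] sl2_22[OF assms(2)] of_nat_add
      by (simp add: algebra_simps)
  qed
  finally show "ncoeff (act (embed (\<alpha>, \<beta>)) (form M g)) m = ncoeff ?r m" .
qed

definition hbasis :: "nat \<Rightarrow> nat \<times> nat \<Rightarrow> 'n polynomial" where
  "hbasis M = (\<lambda>(a, b). form M (\<lambda>c d. delta M a c * delta M b d))"

lemma weight_le: "mdeg m = M \<Longrightarrow> col_weight m \<le> M" "mdeg m = M \<Longrightarrow> row_weight m \<le> M"
  by (simp_all add: mdeg_eq col_weight_def row_weight_def)

text \<open>\<open>act_form\<close> computes a new coefficient from the old ones at neighbouring
  weights; \<open>delta_action\<close>, applied to each weight separately, converts this into the
  image of a basis vector.\<close>

lemma act_hbasis:
  assumes "\<alpha> \<in> sl" "\<beta> \<in> sl" "a \<le> M" "b \<le> M"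
  shows "act (embed (\<alpha>, \<beta>)) (hbasis M (a, b)) =
      (pscale (\<alpha>$1$1 * (of_nat M - 2 * of_nat a)) (hbasis M (a, b))
        + pscale (\<alpha>$1$2 * of_nat a) (hbasis M (a - 1, b))
        + pscale (\<alpha>$2$1 * of_nat (M - a)) (hbasis M (Suc a, b)))
    + (pscale (\<beta>$1$1 * (of_nat M - 2 * of_nat b)) (hbasis M (a, b))
        + pscale (\<beta>$1$2 * of_nat b) (hbasis M (a, b - 1))
        + pscale (\<beta>$2$1 * of_nat (M - b)) (hbasis M (a, Suc b)))"
    (is "_ = ?r")
proof (rule poly_eqI_ncoeff)
  fix m
  show "ncoeff (act (embed (\<alpha>, \<beta>)) (hbasis M (a, b))) m = ncoeff ?r m"
  proof (cases "mdeg m = M")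
    case True
    define c d where "c = col_weight m" and "d = row_weight m"
    have "ncoeff (act (embed (\<alpha>, \<beta>)) (hbasis M (a, b))) m
        = (\<alpha>$1$1 * (of_nat M - 2 * of_nat c) * delta M a c + \<alpha>$1$2 * of_nat (M - c) * delta M a (Suc c)
            + \<alpha>$2$1 * of_nat c * delta M a (c - 1)) * delta M b d
        + (\<beta>$1$1 * (of_nat M - 2 * of_nat d) * delta M b d + \<beta>$1$2 * of_nat (M - d) * delta M b (Suc d)
            + \<beta>$2$1 * of_nat d * delta M b (d - 1)) * delta M a c"
      using True unfolding hbasis_def act_form[OF assms(1,2)] prod.case ncoeff_form c_def d_def
      by (simp add: algebra_simps)
    also have "\<dots> = ncoeff ?r m"
      using True weight_le[OF True] unfolding hbasis_def prod.case ncoeff_add ncoeff_pscale ncoeff_form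
      by (subst (1 2) delta_action)
         (use assms in \<open>simp_all add: c_def d_def algebra_simps\<close>)
    finally show ?thesis .
  qed (simp add: hbasis_def act_form[OF assms(1,2)] ncoeff_form)
qed

lemma ncoeff_hbasis_sum:
  assumes "c \<le> M" "d \<le> M" "mdeg m = M" "col_weight m = c" "row_weight m = d"
  shows "ncoeff (\<Sum>i\<in>{..M} \<times> {..M}. pscale (k i) (hbasis M i)) m
    = k (c, d) * (weight_const M c * weight_const M d)"
proof -
  have "ncoeff (\<Sum>i\<in>{..M} \<times> {..M}. pscale (k i) (hbasis M i)) m
      = (\<Sum>i\<in>{..M} \<times> {..M}. if i = (c, d) then k (c, d) * (weight_const M c * weight_const M d) else 0)"
    unfolding ncoeff_sum
    by (intro sum.cong) (auto simp: hbasis_def ncoeff_form delta_def assms split: if_splits)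
  then show ?thesis using assms(1,2) by simp
qed

lemma hbasis_independent:
  assumes "(\<Sum>i\<in>{..M} \<times> {..M}. pscale (k i) (hbasis M i)) = 0" "i \<in> {..M} \<times> {..M}"
  shows "k i = 0"
proof -
  obtain c d where i: "i = (c, d)" "c \<le> M" "d \<le> M" using assms(2) by auto
  have "k (c, d) * (weight_const M c * weight_const M d) = 0"
    using ncoeff_hbasis_sum[OF i(2,3) exponent[OF i(2,3)], of k] assms(1) by simp
  then show ?thesis by (simp add: i)
qed

lemma hbasis_harmonic: "hbasis M i \<in> harmonic M"
  by (cases i) (simp add: hbasis_def form_harmonic)

lemma harmonic_expansion:
  assumes "f \<in> harmonic M"
  shows "\<exists>k. f = (\<Sum>i\<in>{..M} \<times> {..M}. pscale (k i) (hbasis M i))"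
proof -
  \<comment> \<open>The coefficient at the representative, divided by the value of the weighted
    delta functions at their own weights.\<close>
  define k where "k = (\<lambda>(a, b). ncoeff f (exponent M a b) / (weight_const M a * weight_const M b))"
  have "f = (\<Sum>i\<in>{..M} \<times> {..M}. pscale (k i) (hbasis M i))" (is "f = ?s")
  proof (rule poly_eqI_ncoeff)
    fix m
    show "ncoeff f m = ncoeff ?s m"
    proof (cases "mdeg m = M")
      case True
      then show ?thesis
        using ncoeff_hbasis_sum[OF weight_le[OF True] True refl refl, of k] harmonic_ncoeff[OF assms True]
        by (simp add: k_def)
    next
      case False
      have "?s \<in> homog M"
        using harmonic_homog[OF hbasis_harmonic]
        by (intro pm.subspace_sum pm.subspace_scale subspace_homog)
      with False show ?thesis
        using harmonic_homog[OF assms] by (simp add: ncoeff_homog)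
    qed
  qed
  then show ?thesis by blast
qed

text \<open>The infinitesimal form of the invariance of the determinant under multiplication by
  matrices of determinant 1 on either side.\<close>

lemma act_embed_qform:
  assumes "\<alpha> \<in> sl" "\<beta> \<in> sl"
  shows "act (embed (\<alpha>, \<beta>)) qform = 0"
  by (simp add: qform_def act_minus act_mult act_var sum_univ embed_def col_def row_def
      sl2_22[OF assms(1)] sl2_22[OF assms(2)] distrib_left distrib_right right_diff_distrib left_diff_distrib pscale_mult
      pm.scale_left_distrib mult.commute)

lemma act_qmult_pow:
  assumes "\<alpha> \<in> sl" "\<beta> \<in> sl"
  shows "act (embed (\<alpha>, \<beta>)) ((qmult ^^ l) f) = (qmult ^^ l) (act (embed (\<alpha>, \<beta>)) f)"
  by (induction l) (simp_all add: qmult_def act_mult act_embed_qform[OF assms])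

end

section \<open>Tensor products\<close>

text \<open>The structure constants of a tensor product of two standard bases, stated without
  tensors so that polynomials can satisfy them.\<close>

definition double_standard_basis ::
  "((complex^2^2) \<times> (complex^2^2) \<Rightarrow> ('b \<Rightarrow>\<^sub>0 complex) \<Rightarrow> ('b \<Rightarrow>\<^sub>0 complex)) \<Rightarrow> ('b \<Rightarrow>\<^sub>0 complex) set
     \<Rightarrow> nat \<Rightarrow> (nat \<times> nat \<Rightarrow> ('b \<Rightarrow>\<^sub>0 complex)) \<Rightarrow> bool" where
  "double_standard_basis \<sigma> W M w \<longleftrightarrow>
     pm.independent (w ` ({..M} \<times> {..M})) \<and> inj_on w ({..M} \<times> {..M}) \<and> pm.span (w ` ({..M} \<times> {..M})) = W \<and>
     (\<forall>\<alpha>\<in>sl. \<forall>\<beta>\<in>sl. \<forall>a\<le>M. \<forall>b\<le>M. \<sigma> (\<alpha>, \<beta>) (w (a, b)) =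
        (pscale (\<alpha>$1$1 * (of_nat M - 2 * of_nat a)) (w (a, b))
          + pscale (\<alpha>$1$2 * of_nat a) (w (a - 1, b))
          + pscale (\<alpha>$2$1 * of_nat (M - a)) (w (Suc a, b)))
      + (pscale (\<beta>$1$1 * (of_nat M - 2 * of_nat b)) (w (a, b))
          + pscale (\<beta>$1$2 * of_nat b) (w (a, b - 1))
          + pscale (\<beta>$2$1 * of_nat (M - b)) (w (a, Suc b))))"

lemma span_family_expansion:
  assumes "finite I" "inj_on x I" "u \<in> pm.span (x ` I)"
  shows "\<exists>c. u = (\<Sum>i\<in>I. pscale (c i) (x i))"
proof -
  obtain d where "u = (\<Sum>y\<in>x ` I. pscale (d y) y)"
    using assms(1,3) by (auto simp: pm.span_finite)
  then show ?thesis by (intro exI[of _ "\<lambda>i. d (x i)"]) (simp add: sum.reindex[OF assms(2)])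
qed

lemma double_standard_basis_nonzero:
  assumes "double_standard_basis \<sigma> W M w" "a \<le> M" "b \<le> M"
  shows "w (a, b) \<noteq> 0"
proof
  assume "w (a, b) = 0"
  then have "0 \<in> w ` ({..M} \<times> {..M})" using assms(2,3) by (intro image_eqI[of _ _ "(a, b)"]) auto
  then have "pm.dependent (w ` ({..M} \<times> {..M}))" by (rule pm.dependent_zero)
  then show False using assms(1) by (simp add: double_standard_basis_def)
qed

lemma double_standard_basis_dim:
  assumes "double_standard_basis \<sigma> W M w"
  shows "pm.dim W = (M + 1)\<^sup>2"
proof -
  have ind: "pm.independent (w ` ({..M} \<times> {..M}))" and inj: "inj_on w ({..M} \<times> {..M})"
    and W: "W = pm.span (w ` ({..M} \<times> {..M}))"
    using assms by (auto simp: double_standard_basis_def)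
  show ?thesis
    unfolding W using pm.dim_span_eq_card_independent[OF ind] card_image[OF inj]
    by (simp add: power2_eq_square)
qed

text \<open>A nonzero vector of minimal height in a submodule is killed by both raising operators, hence
  a multiple of \<open>w (0, 0)\<close>, which generates the whole module under the lowering operators.\<close>

lemma double_standard_basis_simple:
  assumes basis: "double_standard_basis \<sigma> W M w"
    and op: "\<And>x. x \<in> sl \<times> sl \<Longrightarrow> linear_operator_on W (\<sigma> x)"
    and U: "pm.subspace U" "U \<subseteq> W" "U \<noteq> {0}" "\<And>x. x \<in> sl \<times> sl \<Longrightarrow> \<sigma> x ` U \<subseteq> U"
  shows "U = W"
proof -
  let ?G = "{..M} \<times> {..M}"
  have ind: "pm.independent (w ` ?G)" and inj: "inj_on w ?G" and W: "pm.span (w ` ?G) = W"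
    and act: "\<And>\<alpha> \<beta> a b. \<alpha> \<in> sl \<Longrightarrow> \<beta> \<in> sl \<Longrightarrow> a \<le> M \<Longrightarrow> b \<le> M \<Longrightarrow> \<sigma> (\<alpha>, \<beta>) (w (a, b)) =
        (pscale (\<alpha>$1$1 * (of_nat M - 2 * of_nat a)) (w (a, b))
          + pscale (\<alpha>$1$2 * of_nat a) (w (a - 1, b))
          + pscale (\<alpha>$2$1 * of_nat (M - a)) (w (Suc a, b)))
      + (pscale (\<beta>$1$1 * (of_nat M - 2 * of_nat b)) (w (a, b))
          + pscale (\<beta>$1$2 * of_nat b) (w (a, b - 1))
          + pscale (\<beta>$2$1 * of_nat (M - b)) (w (a, Suc b)))"
    using basis by (auto simp: double_standard_basis_def)
  define e1 e2 f1 f2 where defs: "e1 = \<sigma> (raise, 0)" "e2 = \<sigma> (0, raise)" "f1 = \<sigma> (lower, 0)" "f2 = \<sigma> (0, lower)"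
  interpret e1: linear_operator_on W e1 unfolding defs by (rule op) (simp add: sl2_in_sl sl_zero)
  interpret e2: linear_operator_on W e2 unfolding defs by (rule op) (simp add: sl2_in_sl sl_zero)
  have e1: "e1 (w (a, b)) = pscale (of_nat a) (w (a - 1, b))"
    and e2: "e2 (w (a, b)) = pscale (of_nat b) (w (a, b - 1))"
    and f1: "f1 (w (a, b)) = pscale (of_nat (M - a)) (w (Suc a, b))"
    and f2: "f2 (w (a, b)) = pscale (of_nat (M - b)) (w (a, Suc b))" if "a \<le> M" "b \<le> M" for a b
    using that by (simp_all add: defs act sl2_in_sl sl_zero) (simp_all add: raise_def lower_def)
  have UU: "e1 u \<in> U" "e2 u \<in> U" "f1 u \<in> U" "f2 u \<in> U" if "u \<in> U" for u
    unfolding defs using that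
    by (auto intro!: U(4)[THEN subsetD] simp: sl2_in_sl sl_zero)
  have wW: "w (a, b) \<in> W" if "a \<le> M" "b \<le> M" for a b
    using that by (auto simp: W[symmetric] intro!: pm.span_base)
  have w_nonzero: "w (0, 0) \<noteq> 0" using double_standard_basis_nonzero[OF basis] by blast

  \<comment> \<open>A filtration by the height \<open>a + b\<close>: both raising operators map the
    span for \<open>H (Suc d)\<close> into the span for \<open>H d\<close>.\<close>
  define H where "H d = {(a, b). a \<le> M \<and> b \<le> M \<and> a + b \<le> d}" for d
  have top: "w (0, 0) \<in> U" if "u \<in> U" "u \<noteq> 0" "u \<in> pm.span (w ` H d)" for u d
    using that
  proof (induction d arbitrary: u)
    case 0
    have "H 0 = {(0, 0)}" by (auto simp: H_def)
    with 0 obtain k where k: "u = pscale k (w (0, 0))" by (auto simp: pm.span_singleton)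
    then have "k \<noteq> 0" using 0 by auto
    moreover have "pscale (inverse k) u \<in> U" using 0(1) by (rule pm.subspace_scale[OF U(1)])
    ultimately show ?case by (simp add: k)
  next
    case (Suc d)
    have sub: "w ` H (Suc d) \<subseteq> W" using wW by (auto simp: H_def)
    have lowered: "e1 u \<in> pm.span (w ` H d)" "e2 u \<in> pm.span (w ` H d)"
    proof -
      have "e1 x \<in> pm.span (w ` H d) \<and> e2 x \<in> pm.span (w ` H d)" if "x \<in> w ` H (Suc d)" for x
      proof -
        obtain a b where x: "x = w (a, b)" "a \<le> M" "b \<le> M" "a + b \<le> Suc d" using \<open>x \<in> _\<close> by (auto simp: H_def)
        have "e1 x \<in> pm.span (w ` H d)"
          using x e1[OF x(2,3)] by (cases a) (auto simp: H_def pm.span_zero intro!: pm.span_scale intro: pm.span_base)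
        moreover have "e2 x \<in> pm.span (w ` H d)"
          using x e2[OF x(2,3)] by (cases b) (auto simp: H_def pm.span_zero intro!: pm.span_scale intro: pm.span_base)
        ultimately show ?thesis ..
      qed
      then show "e1 u \<in> pm.span (w ` H d)" "e2 u \<in> pm.span (w ` H d)"
        using e1.span_image[OF sub _ pm.subspace_span Suc.prems(3)]
          e2.span_image[OF sub _ pm.subspace_span Suc.prems(3)] by blast+
    qed
    show ?case
    proof (cases "e1 u = 0 \<and> e2 u = 0")
      case False
      then show ?thesis using Suc.IH lowered UU Suc.prems(1) by blast
    next
      case True
      have "u \<in> pm.span (w ` ?G)" using Suc.prems(1) U(2) W by auto
      then obtain c where c: "u = (\<Sum>i\<in>?G. pscale (c i) (w i))"
        using span_family_expansion[OF _ inj] by auto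
      have wi: "pscale k (w i) \<in> W" if "i \<in> ?G" for i k
        using that wW by (cases i) (auto intro!: pm.subspace_scale[OF e1.subspace])
      have wi': "w i \<in> W" if "i \<in> ?G" for i
        using wi[OF that, of 1] by simp
      have "(\<Sum>i\<in>?G. pscale (c i * of_nat (fst i)) (w (fst i - 1, snd i))) = e1 u"
        unfolding c by (subst e1.sum[OF wi], assumption, intro sum.cong) (auto simp: e1.scale wi' e1)
      \<comment> \<open>The terms with first index 0 vanish; they are dropped because
        \<open>0 - 1 = 0\<close> would make the shift of indices non-injective.\<close>
      then have "(\<Sum>i\<in>{1..M} \<times> {..M}. pscale (c i * of_nat (fst i)) (w (fst i - 1, snd i))) = 0"
        using True by (subst (asm) sum.mono_neutral_right[of ?G "{1..M} \<times> {..M}"]) auto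
      moreover have "inj_on (\<lambda>i. w (fst i - 1, snd i)) ({1..M} \<times> {..M})"
      proof (rule inj_onI)
        fix i j assume "i \<in> {1..M} \<times> {..M}" "j \<in> {1..M} \<times> {..M}" "w (fst i - 1, snd i) = w (fst j - 1, snd j)"
        moreover from this have "(fst i - 1, snd i) = (fst j - 1, snd j)"
          by (intro inj_onD[OF inj]) auto
        ultimately show "i = j" by (auto simp: prod_eq_iff)
      qed
      moreover have "(\<lambda>i. w (fst i - 1, snd i)) ` ({1..M} \<times> {..M}) \<subseteq> w ` ?G"
        by auto
      ultimately have c1: "c i * of_nat (fst i) = 0" if "i \<in> {1..M} \<times> {..M}" for i
        using that pm.independent_mono[OF ind]
        by (intro independent_family_zero[of "\<lambda>i. w (fst i - 1, snd i)" "{1..M} \<times> {..M}" "\<lambda>i. c i * of_nat (fst i)"]) auto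
      have "(\<Sum>i\<in>?G. pscale (c i * of_nat (snd i)) (w (fst i, snd i - 1))) = e2 u"
        unfolding c by (subst e2.sum[OF wi], assumption, intro sum.cong) (auto simp: e2.scale wi' e2)
      then have "(\<Sum>i\<in>{..M} \<times> {1..M}. pscale (c i * of_nat (snd i)) (w (fst i, snd i - 1))) = 0"
        using True by (subst (asm) sum.mono_neutral_right[of ?G "{..M} \<times> {1..M}"]) auto
      moreover have "inj_on (\<lambda>i. w (fst i, snd i - 1)) ({..M} \<times> {1..M})"
      proof (rule inj_onI)
        fix i j assume "i \<in> {..M} \<times> {1..M}" "j \<in> {..M} \<times> {1..M}" "w (fst i, snd i - 1) = w (fst j, snd j - 1)"
        moreover from this have "(fst i, snd i - 1) = (fst j, snd j - 1)"
          by (intro inj_onD[OF inj]) auto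
        ultimately show "i = j" by (auto simp: prod_eq_iff)
      qed
      moreover have "(\<lambda>i. w (fst i, snd i - 1)) ` ({..M} \<times> {1..M}) \<subseteq> w ` ?G"
        by auto
      ultimately have c2: "c i * of_nat (snd i) = 0" if "i \<in> {..M} \<times> {1..M}" for i
        using that pm.independent_mono[OF ind]
        by (intro independent_family_zero[of "\<lambda>i. w (fst i, snd i - 1)" "{..M} \<times> {1..M}" "\<lambda>i. c i * of_nat (snd i)"]) auto
      \<comment> \<open>The two raising operators give \<open>c i * fst i = 0\<close> and
        \<open>c i * snd i = 0\<close>, and only \<open>(0, 0)\<close> escapes both.\<close>
      have "c i = 0" if "i \<in> ?G" "i \<noteq> (0, 0)" for i
        using that c1[of i] c2[of i] by (cases i) (auto simp: Suc_le_eq)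
      then have "u = (\<Sum>i\<in>?G. if i = (0, 0) then pscale (c (0, 0)) (w (0, 0)) else 0)"
        unfolding c by (intro sum.cong) auto
      then have u: "u = pscale (c (0, 0)) (w (0, 0))" by simp
      then have "c (0, 0) \<noteq> 0" using Suc.prems(2) by auto
      then have "pscale (inverse (c (0, 0))) u = w (0, 0)" by (subst u) simp
      moreover have "pscale (inverse (c (0, 0))) u \<in> U"
        using Suc.prems(1) by (rule pm.subspace_scale[OF U(1)])
      ultimately show ?thesis by simp
    qed
  qed
  obtain u where u: "u \<in> U" "u \<noteq> 0" using U(3) pm.subspace_0[OF U(1)] by auto
  have "H (M + M) = ?G" by (auto simp: H_def)
  then have "w (0, 0) \<in> U" using top[OF u, of "M + M"] u(1) U(2) W by auto
  have step: "x \<in> U" if "pscale (of_nat k) x \<in> U" "k \<noteq> 0" for k x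
    using pm.subspace_scale[OF U(1) that(1), of "inverse (of_nat k)"] that(2) by simp
  have 1: "w (a, 0) \<in> U" if "a \<le> M" for a
    using that
  proof (induction a)
    case (Suc a)
    then have "pscale (of_nat (M - a)) (w (Suc a, 0)) \<in> U"
      using UU(3)[of "w (a, 0)"] f1[of a 0] by simp
    then show ?case by (rule step) (use Suc in simp)
  qed (rule \<open>w (0, 0) \<in> U\<close>)
  have "w (a, b) \<in> U" if "a \<le> M" "b \<le> M" for a b
    using that
  proof (induction b)
    case (Suc b)
    then have "pscale (of_nat (M - b)) (w (a, Suc b)) \<in> U"
      using UU(4)[of "w (a, b)"] f2[of a b] by simp
    then show ?case by (rule step) (use Suc in simp)
  qed (simp add: 1)
  then have "W \<subseteq> U" unfolding W[symmetric] by (intro pm.span_minimal U(1)) auto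
  with U(2) show ?thesis by auto
qed

section \<open>Pure tensors and the tensor square of a standard basis\<close>

lemma tensor_add_left: "tensor (u + u') v = tensor u v + tensor u' v"
  and tensor_add_right: "tensor u (v + v') = tensor u v + tensor u v'"
  and tensor_pscale_left: "tensor (pscale c u) v = pscale c (tensor u v)"
  and tensor_pscale_right: "tensor u (pscale c v) = pscale c (tensor u v)"
  by (rule poly_mapping_eqI; clarify; simp add: lookup_add lookup_tensor algebra_simps)+

lemma tensor_zero: "tensor 0 v = 0" "tensor u 0 = 0"
  by (simp_all add: tensor_def)

lemma span_tensor:
  assumes "u \<in> pm.span S" "v \<in> pm.span S'"
  shows "tensor u v \<in> pm.span {tensor x y | x y. x \<in> S \<and> y \<in> S'}" (is "_ \<in> pm.span ?T")
proof -
  have 1: "tensor x v \<in> pm.span ?T" if "x \<in> S" for x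
    using assms(2)
  proof (rule pm.span_induct)
    show "pm.subspace {v. tensor x v \<in> pm.span ?T}"
      by (simp add: pm.subspace_def tensor_add_right tensor_pscale_right tensor_zero
          pm.span_add pm.span_scale pm.span_zero)
  qed (use that in \<open>auto intro: pm.span_base\<close>)
  show ?thesis
    using assms(1)
  proof (rule pm.span_induct)
    show "pm.subspace {u. tensor u v \<in> pm.span ?T}"
      by (simp add: pm.subspace_def tensor_add_left tensor_pscale_left tensor_zero
          pm.span_add pm.span_scale pm.span_zero)
  qed (rule 1)
qed

text \<open>Fixing the coordinate \<open>m\<close> in the first factor gives a relation between the
  \<open>x b\<close>. Its coefficients vanish for every \<open>m\<close>, and this is in turn a
  relation between the \<open>x a\<close>.\<close>

lemma tensor_family_independent:
  assumes "pm.independent (x ` I)" "inj_on x I" "finite I"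
    and "(\<Sum>i\<in>I \<times> I. pscale (c i) (tensor (x (fst i)) (x (snd i)))) = 0" "i \<in> I \<times> I"
  shows "c i = 0"
proof -
  obtain a b where i: "i = (a, b)" "a \<in> I" "b \<in> I" using assms(5) by auto
  have "(\<Sum>b\<in>I. pscale (\<Sum>a\<in>I. c (a, b) * lookup (x a) m) (x b)) = 0" for m
  proof (rule poly_mapping_eqI)
    fix n
    have "lookup (\<Sum>b\<in>I. pscale (\<Sum>a\<in>I. c (a, b) * lookup (x a) m) (x b)) n
        = (\<Sum>a\<in>I. \<Sum>b\<in>I. c (a, b) * (lookup (x a) m * lookup (x b) n))"
      by (subst sum.swap) (simp add: lookup_sum sum_distrib_right mult.assoc)
    also have "\<dots> = lookup (\<Sum>i\<in>I \<times> I. pscale (c i) (tensor (x (fst i)) (x (snd i)))) (m, n)"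
      by (simp add: lookup_sum lookup_tensor sum.cartesian_product case_prod_beta)
    finally show "lookup (\<Sum>b\<in>I. pscale (\<Sum>a\<in>I. c (a, b) * lookup (x a) m) (x b)) n = lookup 0 n"
      using assms(4) by simp
  qed
  then have "(\<Sum>a\<in>I. c (a, b) * lookup (x a) m) = 0" for m
    by (rule independent_family_zero[OF assms(1-3)]) (rule i(3))
  then have "(\<Sum>a\<in>I. pscale (c (a, b)) (x a)) = 0"
    by (intro poly_mapping_eqI) (simp add: lookup_sum)
  then show ?thesis
    unfolding i(1) by (rule independent_family_zero[OF assms(1-3)]) (rule i(2))
qed

lemma subspace_tensor_space: "pm.subspace (tensor_space V W)"
  by (simp add: tensor_space_def)

lemma tensor_in_tensor_space: "u \<in> V \<Longrightarrow> v \<in> W \<Longrightarrow> tensor u v \<in> tensor_space V W"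
  by (auto simp: tensor_space_def intro: pm.span_base)

theorem tensor_square_isomorphic:
  fixes V :: "('b \<Rightarrow>\<^sub>0 complex) set" and W :: "('c \<Rightarrow>\<^sub>0 complex) set"
  assumes mod: "lie_module sl \<rho> V" and v: "standard_basis \<rho> V M v"
    and w: "double_standard_basis \<sigma> W M w"
    and op: "\<And>x. x \<in> sl \<times> sl \<Longrightarrow> linear_operator_on W (\<sigma> x)"
  shows "\<exists>\<tau>. tensor_action \<rho> V \<tau> \<and> module_isomorphic (sl \<times> sl) \<tau> (tensor_space V V) \<sigma> W"
proof -
  let ?G = "{..M} \<times> {..M}"
  have v_ind: "pm.independent (v ` {..M})" and v_inj: "inj_on v {..M}" and V: "pm.span (v ` {..M}) = V"
    and v_act: "\<And>a c. a \<in> sl \<Longrightarrow> c \<le> M \<Longrightarrow> \<rho> a (v c) = pscale (a$1$1 * (of_nat M - 2 * of_nat c)) (v c)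
        + pscale (a$1$2 * of_nat c) (v (c - 1)) + pscale (a$2$1 * of_nat (M - c)) (v (Suc c))"
    using v by (auto simp: standard_basis_def)
  have w_ind: "pm.independent (w ` ?G)" and w_inj: "inj_on w ?G" and W: "pm.span (w ` ?G) = W"
    using w by (auto simp: double_standard_basis_def)
  have subV: "pm.subspace V" and subW: "pm.subspace W"
    by (simp_all flip: V W)
  have opV: "linear_operator_on V (\<rho> a)" if "a \<in> sl" for a
    using mod that by unfold_locales (auto simp: lie_module_def)
  define t where "t i = tensor (v (fst i)) (v (snd i))" for i
  have t_ind: "inj_on t ?G" "pm.independent (t ` ?G)"
    by (rule independent_familyI;
        use tensor_family_independent[OF v_ind v_inj] in \<open>auto simp: t_def\<close>)+
  have T: "tensor_space V V = pm.span (t ` ?G)"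
  proof
    have "t ` ?G = {tensor x y | x y. x \<in> v ` {..M} \<and> y \<in> v ` {..M}}"
      by (force simp: t_def)
    then show "tensor_space V V \<subseteq> pm.span (t ` ?G)"
      unfolding tensor_space_def using span_tensor[of _ "v ` {..M}" _ "v ` {..M}"] V
      by (intro pm.span_minimal) auto
    have "v c \<in> V" if "c \<le> M" for c
      using that by (auto simp: V[symmetric] intro: pm.span_base)
    then show "pm.span (t ` ?G) \<subseteq> tensor_space V V"
      by (intro pm.span_minimal subspace_tensor_space) (auto simp: t_def intro!: tensor_in_tensor_space)
  qed
  interpret vp: vector_space_pair "pscale :: complex \<Rightarrow> ('b \<times> 'b \<Rightarrow>\<^sub>0 complex) \<Rightarrow> _"
    "pscale :: complex \<Rightarrow> ('c \<Rightarrow>\<^sub>0 complex) \<Rightarrow> _" by unfold_locales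
  obtain F where F: "Vector_Spaces.linear pscale pscale F" and "\<forall>x\<in>t ` ?G. F x = w (inv_into ?G t x)"
    using vp.linear_independent_extend[OF t_ind(2), of "\<lambda>x. w (inv_into ?G t x)"] by blast
  then have Ft: "F (t i) = w i" if "i \<in> ?G" for i
    using that inv_into_f_f[OF t_ind(1)] by auto
  have Fadd: "F (x + y) = F x + F y" and Fscale: "F (pscale c x) = pscale c (F x)" for x y c
    using F by (simp_all add: vp.linear_add vp.linear_scale)
  have F0: "F 0 = 0" using Fscale[of 0 0] by simp
  have Fsum: "F (\<Sum>i\<in>?G. pscale (c i) (t i)) = (\<Sum>i\<in>?G. pscale (c i) (w i))" for c
    using Ft by (simp add: vp.linear_sum[OF F] Fscale)
  have bij: "bij_betw F (tensor_space V V) W"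
  proof (rule bij_betw_imageI)
    show "inj_on F (tensor_space V V)"
    proof (rule inj_onI)
      fix x y assume xy: "x \<in> tensor_space V V" "y \<in> tensor_space V V" "F x = F y"
      then have "x - y \<in> pm.span (t ` ?G)" using T by (simp add: pm.span_diff)
      then obtain c where c: "x - y = (\<Sum>i\<in>?G. pscale (c i) (t i))"
        using span_family_expansion[OF _ t_ind(1)] by auto
      have "(\<Sum>i\<in>?G. pscale (c i) (w i)) = 0"
        using Fsum[of c] xy(3) Fadd[of "x - y" y] by (simp flip: c)
      then have "c i = 0" if "i \<in> ?G" for i
        using independent_family_zero[OF w_ind w_inj] that by blast
      then show "x = y" using c by simp
    qed
    have "F ` pm.span (t ` ?G) = pm.span (F ` t ` ?G)"
      using vp.linear_span_image[OF F] by simp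
    also have "F ` t ` ?G = w ` ?G" using Ft by (force simp: image_image)
    finally show "F ` tensor_space V V = W" using T W by simp
  qed
  \<comment> \<open>Transport of \<sigma> along \<open>F\<close>; the inverse image exists because
    \<sigma> preserves \<open>W\<close>.\<close>
  define \<tau> where "\<tau> x s = inv_into (tensor_space V V) F (\<sigma> x (F s))" for x s
  have FW: "F s \<in> W" if "s \<in> tensor_space V V" for s
    using bij that by (auto simp: bij_betw_def)
  have \<tau>: "F (\<tau> x s) = \<sigma> x (F s)" "\<tau> x s \<in> tensor_space V V"
    if "x \<in> sl \<times> sl" "s \<in> tensor_space V V" for x s
  proof -
    have "\<sigma> x (F s) \<in> F ` tensor_space V V"
      using linear_operator_on.closed[OF op[OF that(1)] FW[OF that(2)]] bij by (simp add: bij_betw_def)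
    then show "F (\<tau> x s) = \<sigma> x (F s)" "\<tau> x s \<in> tensor_space V V"
      unfolding \<tau>_def by (auto intro: f_inv_into_f inv_into_into)
  qed
  have eqI: "x = y" if "F x = F y" "x \<in> tensor_space V V" "y \<in> tensor_space V V" for x y
    using that bij by (auto simp: bij_betw_def inj_on_def)
  have linear: "linear_map_on (tensor_space V V) (\<tau> x)" if x: "x \<in> sl \<times> sl" for x
    unfolding linear_map_on_def
    by (intro conjI ballI allI; rule eqI)
       (simp_all add: \<tau>[OF x] Fadd Fscale pm.subspace_add[OF subspace_tensor_space]
          pm.subspace_scale[OF subspace_tensor_space] FW linear_operator_on.add[OF op[OF x]]
          linear_operator_on.scale[OF op[OF x]])
  have equivariant: "F (tensor (\<rho> a x) y + tensor x (\<rho> b y)) = \<sigma> (a, b) (F (tensor x y))"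
    if ab: "a \<in> sl" "b \<in> sl" and xy: "x \<in> V" "y \<in> V" for a b x y
  proof -
    interpret ra: linear_operator_on V "\<rho> a" by (rule opV[OF ab(1)])
    interpret rb: linear_operator_on V "\<rho> b" by (rule opV[OF ab(2)])
    interpret s: linear_operator_on W "\<sigma> (a, b)" using ab by (intro op) simp
    \<comment> \<open>Both sides are bilinear, so the identity spreads from basis vectors to
      \<open>V\<close> one argument at a time.\<close>
    define P where "P x y \<longleftrightarrow> F (tensor (\<rho> a x) y + tensor x (\<rho> b y)) = \<sigma> (a, b) (F (tensor x y))" for x y
    have PW: "F (tensor x y) \<in> W" if "x \<in> V" "y \<in> V" for x y
      using that FW tensor_in_tensor_space by blast
    have sub1: "pm.subspace {x \<in> V. P x y}" if "y \<in> V" for y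
      using that subV unfolding pm.subspace_def P_def
      by (auto simp: ra.zero ra.add ra.scale tensor_zero tensor_add_left tensor_pscale_left F0 s.zero
          Fadd Fscale s.add s.scale PW pm.scale_right_distrib[symmetric] add_ac)
    have sub2: "pm.subspace {y \<in> V. P x y}" if "x \<in> V" for x
      using that subV unfolding pm.subspace_def P_def
      by (auto simp: rb.zero rb.add rb.scale tensor_zero tensor_add_right tensor_pscale_right F0 s.zero
          Fadd Fscale s.add s.scale PW pm.scale_right_distrib[symmetric] add_ac)
    have vV: "v c \<in> V" if "c \<le> M" for c
      using that by (auto simp: V[symmetric] intro: pm.span_base)
    have P_basis: "P (v c) (v d)" if "c \<le> M" "d \<le> M" for c d
    proof -
      have F1: "F (tensor (v c') (v d')) = w (c', d')" if "c' \<le> M" "d' \<le> M" for c' d'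
        using Ft[of "(c', d')"] that by (simp add: t_def)
      \<comment> \<open>For \<open>c = M\<close> or \<open>d = M\<close> the next index leaves the
        basis and \<open>F1\<close> says nothing, but the coefficient is zero.\<close>
      have "pscale (k * of_nat (M - c)) (F (tensor (v (Suc c)) (v d))) = pscale (k * of_nat (M - c)) (w (Suc c, d))"
        "pscale (k * of_nat (M - d)) (F (tensor (v c) (v (Suc d)))) = pscale (k * of_nat (M - d)) (w (c, Suc d))" for k
        using that F1 by (cases "c = M"; cases "d = M"; simp)+
      moreover have "\<sigma> (a, b) (w (c, d)) =
          (pscale (a$1$1 * (of_nat M - 2 * of_nat c)) (w (c, d))
            + pscale (a$1$2 * of_nat c) (w (c - 1, d))
            + pscale (a$2$1 * of_nat (M - c)) (w (Suc c, d)))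
        + (pscale (b$1$1 * (of_nat M - 2 * of_nat d)) (w (c, d))
            + pscale (b$1$2 * of_nat d) (w (c, d - 1))
            + pscale (b$2$1 * of_nat (M - d)) (w (c, Suc d)))"
        using w ab that by (simp add: double_standard_basis_def)
      ultimately show ?thesis
        using that by (simp only: P_def v_act ab tensor_add_left tensor_add_right tensor_pscale_left
            tensor_pscale_right Fadd Fscale F1 diff_le_self[THEN order.trans])
    qed
    have "P (v c) y" if "c \<le> M" for c
    proof -
      have "pm.span (v ` {..M}) \<subseteq> {y \<in> V. P (v c) y}"
        by (rule pm.span_minimal[OF _ sub2[OF vV[OF that]]]) (use vV P_basis that in auto)
      then show ?thesis using xy(2) V by auto
    qed
    then have "pm.span (v ` {..M}) \<subseteq> {x \<in> V. P x y}"
      by (intro pm.span_minimal sub1 xy(2)) (use vV in auto)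
    then have "P x y" using xy(1) V by auto
    then show ?thesis by (simp add: P_def)
  qed
  have "tensor_action \<rho> V \<tau>"
    unfolding tensor_action_def
  proof (intro ballI conjI)
    fix a b :: "complex^2^2" assume ab: "a \<in> sl" "b \<in> sl"
    show "linear_map_on (tensor_space V V) (\<tau> (a, b))" using ab by (intro linear) simp
    fix x y assume xy: "x \<in> V" "y \<in> V"
    have "\<rho> a x \<in> V" "\<rho> b y \<in> V"
      by (rule linear_operator_on.closed[OF opV]; fact)+
    with xy ab equivariant[OF ab xy] show "\<tau> (a, b) (tensor x y) = tensor (\<rho> a x) y + tensor x (\<rho> b y)"
      by (intro eqI) (simp_all add: \<tau> tensor_in_tensor_space pm.subspace_add[OF subspace_tensor_space])
  qed
  moreover have "module_isomorphic (sl \<times> sl) \<tau> (tensor_space V V) \<sigma> W"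
    unfolding module_isomorphic_def using bij \<tau>(1)
    by (intro exI[of _ F]) (auto simp: linear_map_on_def Fadd Fscale)
  ultimately show ?thesis by blast
qed

section \<open>The Lie subalgebras and the summands\<close>

context quadric
begin

text \<open>Powers of \<open>qmult\<close> are injective on harmonic polynomials and commute with
  the action, so they carry \<open>hbasis\<close> over with its constants.\<close>

lemma double_standard_basis_component:
  assumes "l \<le> N div 2"
  shows "double_standard_basis (\<lambda>x. act (embed x)) (component N l) (N - 2 * l)
    (\<lambda>i. (qmult ^^ l) (hbasis (N - 2 * l) i))"
proof -
  let ?M = "N - 2 * l" and ?G = "{..N - 2 * l} \<times> {..N - 2 * l}" and ?w = "\<lambda>i. (qmult ^^ l) (hbasis (N - 2 * l) i)"
  have zero: "(qmult ^^ l) 0 = 0" by (induction l) (simp_all add: qmult_0)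
  have sum: "(\<Sum>i\<in>I. pscale (k i) (?w i)) = (qmult ^^ l) (\<Sum>i\<in>I. pscale (k i) (hbasis ?M i))"
    if "finite I" for k and I :: "(nat \<times> nat) set"
    using that by (induction I rule: finite_induct) (simp_all add: zero qmult_pow_add qmult_pow_pscale)
  have "k i = 0" if 0: "(\<Sum>i\<in>?G. pscale (k i) (?w i)) = 0" and i: "i \<in> ?G" for k i
  proof -
    have "(\<Sum>i\<in>?G. pscale (k i) (hbasis ?M i)) \<in> harmonic ?M"
      by (intro pm.subspace_sum pm.subspace_scale subspace_harmonic hbasis_harmonic)
    then have "(\<Sum>i\<in>?G. pscale (k i) (hbasis ?M i)) = 0"
      by (rule qmult_inj[where l = l]) (simp add: 0 flip: sum)
    then show "k i = 0" using i by (rule hbasis_independent)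
  qed
  then have "inj_on ?w ?G" "pm.independent (?w ` ?G)"
    using independent_familyI[of ?G ?w] by blast+
  moreover have "pm.span (?w ` ?G) = component N l"
  proof
    show "pm.span (?w ` ?G) \<subseteq> component N l"
      using hbasis_harmonic by (intro pm.span_minimal subspace_component) (auto simp: component_def)
    show "component N l \<subseteq> pm.span (?w ` ?G)"
    proof
      fix f assume "f \<in> component N l"
      then obtain h where h: "h \<in> harmonic ?M" "f = (qmult ^^ l) h" by (auto simp: component_def)
      then obtain k where "h = (\<Sum>i\<in>?G. pscale (k i) (hbasis ?M i))" using harmonic_expansion by blast
      then have "f = (\<Sum>i\<in>?G. pscale (k i) (?w i))" by (simp add: sum h(2))
      then show "f \<in> pm.span (?w ` ?G)"
        by (auto intro!: pm.span_sum pm.span_scale intro: pm.span_base)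
    qed
  qed
  ultimately show ?thesis
    by (simp add: double_standard_basis_def act_qmult_pow act_hbasis qmult_pow_add qmult_pow_pscale)
qed

text \<open>Invariance needs no commutation with the Laplacian: harmonic polynomials are forms, and
  \<open>act_form\<close> returns a form.\<close>

lemma linear_operator_on_component:
  assumes "x \<in> sl \<times> sl" "l \<le> N div 2"
  shows "linear_operator_on (component N l) (act (embed x))"
proof
  show "linear_map_on (component N l) (act (embed x))"
    by (simp add: linear_map_on_def act_add act_pscale)
  obtain a b where x: "x = (a, b)" "a \<in> sl" "b \<in> sl" using assms(1) by auto
  let ?M = "N - 2 * l"
  have "act (embed x) h \<in> harmonic ?M" if "h \<in> harmonic ?M" for h
    by (subst harmonic_eq_form[OF that]) (simp only: x(1) act_form[OF x(2,3)] form_harmonic)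
  then show "act (embed x) ` component N l \<subseteq> component N l"
    by (auto simp: component_def x act_qmult_pow)
qed (rule subspace_component)

section \<open>The embedding of \<open>sl \<times> sl\<close> as a Lie algebra\<close>

lemma embed_add: "embed (a + a', b + b') = embed (a, b) + embed (a', b')"
  by (simp add: embed_def vec_eq_iff)

lemma embed_mscale: "embed (mscale c a, mscale c b) = mscale c (embed (a, b))"
  by (simp add: embed_def vec_eq_iff mscale_def algebra_simps)

text \<open>The product of two Kronecker sums. The mixed terms in the last line are symmetric in the
  two factors and cancel in the bracket.\<close>

lemma embed_mult_sum:
  "(embed (a, b) ** embed (a', b')) $ x $ y
    = (if row x = row y then (a ** a') $ col x $ col y else 0) + (if col x = col y then (b ** b') $ row x $ row y else 0)
      + (a $ col x $ col y * b' $ row x $ row y + b $ row x $ row y * a' $ col x $ col y)"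
proof -
  have "x \<in> {p, q, r, s}" "y \<in> {p, q, r, s}" using univ by auto
  then show ?thesis
    by (elim insertE emptyE;
        simp add: matrix_matrix_mult_def sum_univ sum_2 embed_def col_def row_def algebra_simps)
qed

lemma embed_bracket: "embed (bracket a a', bracket b b') = bracket (embed (a, b)) (embed (a', b'))"
  unfolding bracket_def vec_eq_iff vector_minus_component embed_mult_sum
  by (simp add: embed_def)

lemma embed_zero: "embed (0, 0) = 0"
  by (simp add: embed_def vec_eq_iff)

lemma embed_sl: "x \<in> sl \<times> sl \<Longrightarrow> embed x \<in> sl"
  by (auto simp: sl_def trace_def sum_univ sum_2 embed_def col_def row_def algebra_simps)
     (simp add: add_eq_0_iff)

lemma embed_inj: "inj_on embed (sl \<times> sl)"
proof (rule inj_onI, clarify)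
  fix a b a' b' :: "complex^2^2"
  assume sl: "a \<in> sl" "b \<in> sl" "a' \<in> sl" "b' \<in> sl" and eq: "embed (a, b) = embed (a', b')"
  have e: "embed (a, b) $ x $ y = embed (a', b') $ x $ y" for x y by (simp add: eq)
  have sums: "a$1$1 + b$1$1 = a'$1$1 + b'$1$1" "a$1$1 - b$1$1 = a'$1$1 - b'$1$1"
    using e[of p p] e[of s s] sl2_22[OF sl(2)] sl2_22[OF sl(4)] by (simp_all add: embed_def col_def row_def)
  have half: "y = (y + z + (y - z)) / 2" for y z :: complex by simp
  have "a$1$1 = a'$1$1"
    using half[of "a$1$1" "b$1$1"] half[of "a'$1$1" "b'$1$1"] unfolding sums by simp
  with sums(1) have "a$1$1 = a'$1$1" "b$1$1 = b'$1$1" by simp_all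
  moreover have "a$1$2 = a'$1$2" "a$2$1 = a'$2$1" "b$1$2 = b'$1$2" "b$2$1 = b'$2$1"
    using e[of p r] e[of r p] e[of p s] e[of s p] by (simp_all add: embed_def col_def row_def)
  ultimately show "a = a' \<and> b = b'"
    by (simp add: vec_eq_iff forall_2 sl2_22[OF sl(1)] sl2_22[OF sl(2)] sl2_22[OF sl(3)] sl2_22[OF sl(4)])
qed

text \<open>\<open>A0\<close> is \<open>raise + lower\<close> and \<open>bracket A0star A0\<close>
  is twice \<open>raise - lower\<close>, whence the denominators 2 and 4.\<close>

lemma sl2_generated:
  assumes "a \<in> sl"
  shows "a = mscale (a$1$1) A0star + (mscale ((a$1$2 + a$2$1) / 2) A0
    + mscale ((a$1$2 - a$2$1) / 4) (bracket A0star A0))"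
  by (simp add: vec_eq_iff forall_2 mscale_def A0_def A0star_def bracket_def matrix_matrix_mult_def
      sum_2 sl2_22[OF assms] field_simps)

lemma A0_sl: "A0 \<in> sl" "A0star \<in> sl"
  by (simp_all add: sl_def trace_def A0_def A0star_def sum_2)

lemma embed_image_generated:
  "embed ` (sl \<times> sl) = lie_generated {embed (A0, 0), embed (A0star, 0), embed (0, A0), embed (0, A0star)}"
    (is "_ = lie_generated ?S")
proof
  have "\<exists>a\<in>sl. \<exists>b\<in>sl. m = embed (a, b)" if "m \<in> lie_generated ?S" for m
    using that
  proof induction
    case (base m)
    then show ?case using A0_sl sl_zero by blast
  next
    case zero
    then show ?case using embed_zero sl_zero by metis
  next
    case (add m n)
    then show ?case using embed_add sl_add by metis
  next
    case (scale m c)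
    then show ?case using embed_mscale sl_mscale by metis
  next
    case (bracket m n)
    then show ?case using embed_bracket sl_bracket by metis
  qed
  then show "lie_generated ?S \<subseteq> embed ` (sl \<times> sl)" by blast
  show "embed ` (sl \<times> sl) \<subseteq> lie_generated ?S"
  proof clarify
    fix a b :: "complex^2^2" assume ab: "a \<in> sl" "b \<in> sl"
    \<comment> \<open>With one component kept zero, \<open>sl2_generated\<close> can be applied in
      each summand separately.\<close>
    have hom1: "embed (x + y, 0) = embed (x, 0) + embed (y, 0)" "embed (mscale c x, 0) = mscale c (embed (x, 0))"
      "embed (bracket x y, 0) = bracket (embed (x, 0)) (embed (y, 0))" for x y c
      using embed_add[of x y 0 0] embed_mscale[of c x 0] embed_bracket[of x y 0 0]
      by (simp_all add: bracket_def mscale_def zero_vec_def[symmetric])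
    have hom2: "embed (0, x + y) = embed (0, x) + embed (0, y)" "embed (0, mscale c x) = mscale c (embed (0, x))"
      "embed (0, bracket x y) = bracket (embed (0, x)) (embed (0, y))" for x y c
      using embed_add[of 0 0 x y] embed_mscale[of c 0 x] embed_bracket[of 0 0 x y]
      by (simp_all add: bracket_def mscale_def zero_vec_def[symmetric])
    have "embed (a, 0) \<in> lie_generated ?S"
      by (subst sl2_generated[OF ab(1)], unfold hom1)
         (intro lie_generated.intros(3-5); rule lie_generated.base; simp)
    moreover have "embed (0, b) \<in> lie_generated ?S"
      by (subst sl2_generated[OF ab(2)], unfold hom2)
         (intro lie_generated.intros(3-5); rule lie_generated.base; simp)
    ultimately show "embed (a, b) \<in> lie_generated ?S"
      using embed_add[of a 0 0 b] lie_generated.add by simp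
  qed
qed

lemma irreducible_component:
  assumes "l \<le> N div 2"
  shows "irreducible_module (embed ` (sl \<times> sl)) act (component N l)"
  unfolding irreducible_module_def
proof (intro conjI allI impI)
  note op = linear_operator_on_component[OF _ assms] and basis = double_standard_basis_component[OF assms]
  show "lie_module (embed ` (sl \<times> sl)) act (component N l)"
    using linear_operator_on.invariant[OF op] embed_sl
    by (intro lie_module_restrict[OF lie_module_polynomials] subspace_component) auto
  have "(qmult ^^ l) (hbasis (N - 2 * l) (0, 0)) \<in> component N l"
    unfolding component_def using hbasis_harmonic by blast
  then show "component N l \<noteq> {0}"
    using double_standard_basis_nonzero[OF basis, of 0 0] by auto
  fix U assume U: "U \<subseteq> component N l \<and> lie_module (embed ` (sl \<times> sl)) act U"
  then have "pm.subspace U" "\<And>x. x \<in> sl \<times> sl \<Longrightarrow> act (embed x) ` U \<subseteq> U"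
    unfolding lie_module_def by blast+
  then show "U = {0} \<or> U = component N l"
    using double_standard_basis_simple[OF basis op, of U] U by blast
qed

text \<open>Expand an eigenvector into components: subtracting the eigenvalue equation leaves a
  vanishing sum of multiples of the components, and the eigenvalues differ.\<close>

lemma eigenspace_component:
  assumes "l \<le> N div 2"
  shows "is_eigenspace casimir (homog N) (of_nat ((N - 2 * l) * (N - 2 * l + 2)) / 2) (component N l)"
proof -
  define ev where "ev k = (of_nat ((N - 2 * k) * (N - 2 * k + 2)) / 2 :: complex)" for k
  have ev_inj: "k = l" if "k \<le> N div 2" "ev k = ev l" for k
  proof -
    \<comment> \<open>Equal eigenvalues give equal \<open>N - 2 * k\<close>, and the bound
      \<open>k \<le> N div 2\<close> keeps this subtraction from losing \<open>k\<close>.\<close>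
    have "strict_mono (\<lambda>n::nat. n * (n + 2))"
      by (rule strict_monoI, rule mult_strict_mono) simp_all
    moreover have "(N - 2 * k) * (N - 2 * k + 2) = (N - 2 * l) * (N - 2 * l + 2)"
      using that(2) unfolding ev_def by (simp only: divide_cancel_right of_nat_eq_iff) simp
    ultimately have "N - 2 * k = N - 2 * l"
      using strict_mono_eq[of "\<lambda>n. n * (n + 2)" "N - 2 * k" "N - 2 * l"] by blast
    then show ?thesis using that(1) assms by linarith
  qed
  have casimir_sum: "casimir (\<Sum>k\<in>I. g k) = (\<Sum>k\<in>I. pscale (ev k) (g k))"
    if "finite I" "I \<subseteq> {..N div 2}" "\<And>k. k \<in> I \<Longrightarrow> g k \<in> component N k" for I g
    using that
  proof (induction I)
    case empty
    show ?case using casimir_component[of 0 N 0] pm.subspace_0[OF subspace_component] by simp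
  next
    case (insert k I)
    have "lookup (Omega f) m = of_nat (mdeg m) * lookup f m" for f :: "'n polynomial" and m
      by (simp add: Omega_def lookup_mapp when_def in_keys_iff)
    then have Omega_add: "Omega (f + g) = Omega f + Omega g" for f g :: "'n polynomial"
      by (intro poly_mapping_eqI) (simp add: lookup_add distrib_left)
    have "casimir (f + g) = casimir f + casimir g" for f g
      by (simp add: casimir_def numeral_2_eq_2 Omega_add laplace_add qmult_add pm.scale_right_distrib algebra_simps)
    then show ?case
      using insert casimir_component[of "g k" N k] by (simp add: ev_def)
  qed
  have "f \<in> component N l" if f: "f \<in> homog N" "casimir f = pscale (ev l) f" for f
  proof -
    obtain g where g: "\<And>k. k \<le> N div 2 \<Longrightarrow> g k \<in> component N k" "f = (\<Sum>k\<le>N div 2. g k)"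
      using component_decomposition[OF f(1)] by blast
    have "(\<Sum>k\<le>N div 2. pscale (ev k - ev l) (g k)) = 0"
      using casimir_sum[of "{..N div 2}" g] f(2) g
      by (simp add: pm.scale_left_diff_distrib sum_subtractf pm.scale_sum_right)
    moreover have "\<forall>k\<in>{..N div 2}. pscale (ev k - ev l) (g k) \<in> component N k"
      using g(1) by (intro ballI pm.subspace_scale[OF subspace_component]) simp
    ultimately have zero: "\<forall>k\<in>{..N div 2}. pscale (ev k - ev l) (g k) = 0"
      by (intro component_independent[where N = N]) simp_all
    have "g k = 0" if "k \<le> N div 2" "k \<noteq> l" for k
    proof -
      have "ev k - ev l \<noteq> 0" using ev_inj[OF that(1)] that(2) by auto
      then show ?thesis using bspec[OF zero, of k] that(1) by simp
    qed
    then have "f = (\<Sum>k\<le>N div 2. if k = l then g l else 0)"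
      unfolding g(2) by (intro sum.cong) auto
    then show ?thesis using assms g(1) by simp
  qed
  moreover have "component N l \<noteq> {0}"
    using irreducible_component[OF assms] by (simp add: irreducible_module_def)
  moreover have "component N l \<subseteq> homog N" by (rule component_homog[OF assms])
  ultimately show ?thesis
    unfolding is_eigenspace_def ev_def[symmetric]
    using casimir_component[OF _ assms] by (auto simp: ev_def)
qed

end

section \<open>Specialization to the indices 1, 2, 3\<close>

text \<open>The variable interchanged with the first one by \<open>A i\<close>.\<close>

definition partner :: "nat \<Rightarrow> 4" where
  "partner i = (if i = 1 then 2 else if i = 2 then 3 else 4)"

lemma index_cases:
  assumes "{i, j, k} = {1, 2, 3::nat}"
  obtains "i = 1" "j = 2" "k = 3" | "i = 1" "j = 3" "k = 2" | "i = 2" "j = 1" "k = 3"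
    | "i = 2" "j = 3" "k = 1" | "i = 3" "j = 1" "k = 2" | "i = 3" "j = 2" "k = 1"
proof -
  have "i \<in> {1, 2, 3}" "j \<in> {1, 2, 3}" "k \<in> {1, 2, 3}" using assms by auto
  moreover have "card {i, j, k} = 3" by (simp add: assms)
  then have "i \<noteq> j" "i \<noteq> k" "j \<noteq> k" by (auto simp: card_insert_if split: if_splits)
  ultimately show thesis using that by auto
qed

text \<open>Puts \<open>x\<close> and the variable of \<open>i\<close> on one diagonal of the matrix
  and the variables of \<open>j\<close> and \<open>k\<close> on the other.\<close>

lemma quadric_partner:
  assumes "{i, j, k} = {1, 2, 3}"
  shows "quadric 1 (partner i) (partner j) (partner k)"
proof
  show "distinct [1, partner i, partner j, partner k]"
    using assms by (cases rule: index_cases) (auto simp: partner_def)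
  show "UNIV = {1, partner i, partner j, partner k}"
    using assms by (cases rule: index_cases) (auto simp: partner_def UNIV_4)
qed

text \<open>\<open>A j\<close> swaps the columns within each row, while the first column consists of
  \<open>x\<close> and the variable of \<open>k\<close>, where \<open>Astar k\<close> is 1; hence
  the crossed indices in the identification. The map \<open>embed\<close> is determined by three of
  the four variables.\<close>

lemma partner_operators:
  assumes ijk: "{i, j, k} = {1, 2, 3}"
  shows "L i = quadric.laplace 1 (partner i) (partner j) (partner k)"
    and "R i = quadric.qmult 1 (partner i) (partner j) (partner k)"
    and "summand i N = quadric.component 1 (partner i) (partner j) (partner k) N"
    and "C i = quadric.casimir 1 (partner i) (partner j) (partner k)"
    and "quadric.embed 1 (partner j) (partner k) (A0, 0) = A j"
    and "quadric.embed 1 (partner j) (partner k) (A0star, 0) = Astar k"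
    and "quadric.embed 1 (partner j) (partner k) (0, A0) = A k"
    and "quadric.embed 1 (partner j) (partner k) (0, A0star) = Astar j"
proof -
  interpret quadric 1 "partner i" "partner j" "partner k" by (rule quadric_partner[OF ijk])
  show L: "L i = laplace"
    unfolding fun_eq_iff laplace_def L_def
    using ijk by (cases rule: index_cases) (simp_all add: partner_def D_commute)
  show R: "R i = qmult"
    unfolding fun_eq_iff qmult_def qform_def R_def
    using ijk by (cases rule: index_cases) (simp_all add: partner_def mult.commute)
  show "summand i N = component N"
    by (simp add: fun_eq_iff summand_def component_def harmonic_def L R)
  show "C i = casimir"
    by (simp add: fun_eq_iff C_def casimir_def L R)
  show "embed (A0, 0) = A j" "embed (A0star, 0) = Astar k" "embed (0, A0) = A k" "embed (0, A0star) = Astar j"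
    unfolding vec_eq_iff embed_def col_def row_def A_def Astar_def
    using ijk by (cases rule: index_cases;
      simp add: forall_4 A0_def A0star_def partner_def mat_unit_def)+
qed

lemma lie_sub_eq_embed:
  assumes ijk: "{i, j, k} = {1, 2, 3}"
  shows "lie_sub i = quadric.embed 1 (partner j) (partner k) ` (sl \<times> sl)"
proof -
  interpret quadric 1 "partner i" "partner j" "partner k" by (rule quadric_partner[OF ijk])
  have "{1, 2, 3} - {i} = {j, k}"
    using ijk by (cases rule: index_cases) auto
  then show ?thesis
    unfolding embed_image_generated partner_operators[OF ijk] lie_sub_def
    by (intro arg_cong[of _ _ lie_generated]) auto
qed

lemma lie_identification_embed:
  assumes ijk: "{i, j, k} = {1, 2, 3}"
  shows "lie_identification i j k (quadric.embed 1 (partner j) (partner k))"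
proof -
  interpret quadric 1 "partner i" "partner j" "partner k" by (rule quadric_partner[OF ijk])
  show ?thesis
    unfolding lie_identification_def
    using embed_inj embed_add embed_bracket embed_mscale partner_operators[OF ijk]
    by (simp add: lie_sub_eq_embed[OF ijk] bij_betw_def)
qed

theorem proposition14p2:
  fixes i N :: nat
  assumes "i \<in> {1, 2, 3}"
  shows "orthogonal_direct_sum {..N div 2} (summand i N) (homog N)
    \<and> (\<forall>l \<le> N div 2. irreducible_module (lie_sub i) act (summand i N l))
    \<and> (\<forall>l \<le> N div 2. pm.dim (summand i N l) = (N - 2 * l + 1)\<^sup>2)
    \<and> (\<forall>j k. {i, j, k} = {1, 2, 3} \<longrightarrow>
         (\<exists>\<iota>. lie_identification i j k \<iota> \<and>
           (\<forall>l \<le> N div 2. \<forall>\<rho> (V :: ('b \<Rightarrow>\<^sub>0 complex) set).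
              irreducible_module sl \<rho> V \<and> pm.dim V = (N - 2 * l) + 1 \<longrightarrow>
              (\<exists>\<tau>. tensor_action \<rho> V \<tau> \<and>
                   module_isomorphic (sl \<times> sl) \<tau> (tensor_space V V)
                     (\<lambda>a. act (\<iota> a)) (summand i N l)))))
    \<and> (\<forall>l \<le> N div 2. is_eigenspace (C i) (homog N)
         (of_nat ((N - 2 * l) * (N - 2 * l + 2)) / 2) (summand i N l))"
proof -
  obtain j k where jk: "{i, j, k} = {1, 2, 3}"
    using assms by (auto simp: insert_commute)
  interpret quadric 1 "partner i" "partner j" "partner k" by (rule quadric_partner[OF jk])
  note [simp] = partner_operators(3,4)[OF jk] lie_sub_eq_embed[OF jk]
  have "\<exists>\<tau>. tensor_action \<rho> V \<tau> \<and>
      module_isomorphic (sl \<times> sl) \<tau> (tensor_space V V)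
        (\<lambda>a. act (quadric.embed 1 (partner j') (partner k') a)) (summand i N l)"
    if jk': "{i, j', k'} = {1, 2, 3}" and l: "l \<le> N div 2"
      and V: "irreducible_module sl \<rho> V" "pm.dim V = (N - 2 * l) + 1"
    for j' k' l \<rho> and V :: "('b \<Rightarrow>\<^sub>0 complex) set"
  proof -
    \<comment> \<open>Each order of the other two indices has its own matrix of variables. The
      summand is the same for all of them by \<open>partner_operators\<close>.\<close>
    interpret q: quadric 1 "partner i" "partner j'" "partner k'" by (rule quadric_partner[OF jk'])
    obtain v where v: "standard_basis \<rho> V (N - 2 * l) v"
      using irreducible_sl2_standard_basis[OF V] by blast
    have "lie_module sl \<rho> V" using V(1) by (simp add: irreducible_module_def)
    from tensor_square_isomorphic[OF this v q.double_standard_basis_component[OF l]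
        q.linear_operator_on_component[OF _ l]]
    show ?thesis by (simp only: partner_operators(3)[OF jk'])
  qed
  then have iso: "\<forall>j' k'. {i, j', k'} = {1, 2, 3} \<longrightarrow>
         (\<exists>\<iota>. lie_identification i j' k' \<iota> \<and>
           (\<forall>l \<le> N div 2. \<forall>\<rho> (V :: ('b \<Rightarrow>\<^sub>0 complex) set).
              irreducible_module sl \<rho> V \<and> pm.dim V = (N - 2 * l) + 1 \<longrightarrow>
              (\<exists>\<tau>. tensor_action \<rho> V \<tau> \<and>
                   module_isomorphic (sl \<times> sl) \<tau> (tensor_space V V)
                     (\<lambda>a. act (\<iota> a)) (summand i N l))))"
    using lie_identification_embed by blast
  show ?thesis
    using orthogonal_direct_sum_component[of N] irreducible_component[of _ N]
      double_standard_basis_dim[OF double_standard_basis_component[of _ N]] eigenspace_component[of _ N]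
    by (intro conjI iso) simp_all
qed

end
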